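(* Let $(F,\Psi_+,\Psi_-)$ be an $SU(3)$-structure on a $6$-manifold $M^6$. It can be lifted to a nearly parallel $G_2$-structure on $M^6\times\mathbb{R}$ (with $q$ the coordinate on $\mathbb{R}$) of the form $$\phi=F(q)\wedge dq-\Psi_-(q),$$ where $(F(q),\Psi_+(q),\Psi_-(q))$ is a family of $SU(3)$-structures on $M^6$ depending on $q\in\mathbb{R}$ with value $(F,\Psi_+,\Psi_-)$ at $q=0$, if and only if $(F,\Psi_+,\Psi_-)$ is nearly half flat, i.e. $d\Psi_-=-2F\wedge F$, and such a family satisfies the evolution nearly half flat equations $$\partial_q\Psi_-=4\Psi_+-dF,\qquad d\Psi_+=-\tfrac12\,\partial_q(F\wedge F).$$
   Context: An $SU(3)$-structure on a $6$-manifold is a triple $(F,\Psi_+,\Psi_-)$ such that locally there is a coframe $e^1,\dots,e^6$ with $F=e^{12}+e^{34}+e^{56}$, $\Psi_++i\Psi_-=(e^1+ie^2)\wedge(e^3+ie^4)\wedge(e^5+ie^6)$. It is called nearly half flat if $d\Psi_-=-2F\wedge F$. For a family of $SU(3)$-structures on $M^6$, the $3$-form $\phi=F\wedge dq-\Psi_-$ is a $G_2$-structure on $M^6\times\mathbb{R}$, with $*\phi=\frac12F\wedge F+\Psi_+\wedge dq$, where $*$ is the Hodge star of its metric and orientation. A $G_2$-structure $\phi$ is nearly parallel if $d\phi=4*\phi$. In the evolution equations $d$ is the exterior derivative on $M^6$. *)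

theory Defs
  imports "HOL-Analysis.Analysis"
begin

section \<open>Alternating forms on a vector space\<close>

text \<open>
  A covector of degree \<open>k\<close> is a function on lists of vectors that is multilinear and alternating on
  lists of length \<open>k\<close> and vanishes on lists of any other length, so the operations below need no
  degree arguments.
\<close>

definition alt_form :: "nat \<Rightarrow> ('e::real_vector list \<Rightarrow> real) \<Rightarrow> bool" where
  "alt_form k \<omega> \<longleftrightarrow>
     (\<forall>vs. length vs \<noteq> k \<longrightarrow> \<omega> vs = 0) \<and>
     (\<forall>vs i. length vs = k \<and> i < k \<longrightarrow> linear (\<lambda>v. \<omega> (vs[i := v]))) \<and>
     (\<forall>vs. length vs = k \<and> \<not> distinct vs \<longrightarrow> \<omega> vs = 0)"

text \<open>
  Wedge product as a sum over shuffles: \<open>I\<close> is the set of positions whose vectors are fed to \<open>\<alpha>\<close>, and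
  the sign is that of the shuffle. This is the convention with \<open>(a \<and> b)(u,v) = a(u) b(v) - a(v) b(u)\<close>
  for 1-forms. The values may be real or complex.
\<close>

definition wedge :: "('e list \<Rightarrow> 'r::comm_ring_1) \<Rightarrow> ('e list \<Rightarrow> 'r) \<Rightarrow> 'e list \<Rightarrow> 'r" where
  "wedge \<alpha> \<beta> vs =
     (\<Sum>I \<in> Pow {..<length vs}.
        (-1) ^ card {(i, j). i \<in> I \<and> j \<in> {..<length vs} - I \<and> j < i} *
        \<alpha> (nths vs I) * \<beta> (nths vs (- I)))"

text \<open>\<open>ewedge e [i, j, \<dots>]\<close> is $e^{ij\dots} = e^i \wedge e^j \wedge \dots$\<close>

definition ewedge :: "(nat \<Rightarrow> 'e list \<Rightarrow> real) \<Rightarrow> nat list \<Rightarrow> 'e list \<Rightarrow> real" where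
  "ewedge e is = foldr (\<lambda>i. wedge (e i)) is (\<lambda>vs. if vs = [] then 1 else 0)"

text \<open>Coframes are indexed from 1: \<open>e 1, \<dots>, e n\<close>.\<close>

definition coframe :: "nat \<Rightarrow> (nat \<Rightarrow> 'e::euclidean_space list \<Rightarrow> real) \<Rightarrow> bool" where
  "coframe n e \<longleftrightarrow> DIM('e) = n \<and> (\<forall>i\<in>{1..n}. alt_form 1 (e i)) \<and>
     (\<forall>a. (\<forall>v. (\<Sum>i=1..n. a i * e i [v]) = 0) \<longrightarrow> (\<forall>i\<in>{1..n}. a i = 0))"

definition su3_coframe ::
  "(nat \<Rightarrow> 'e::euclidean_space list \<Rightarrow> real) \<Rightarrow>
     ('e list \<Rightarrow> real) \<Rightarrow> ('e list \<Rightarrow> real) \<Rightarrow> ('e list \<Rightarrow> real) \<Rightarrow> bool" where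
  "su3_coframe e F P N \<longleftrightarrow> coframe 6 e \<and>
     F = (\<lambda>vs. ewedge e [1,2] vs + ewedge e [3,4] vs + ewedge e [5,6] vs) \<and>
     (\<lambda>vs. Complex (P vs) (N vs)) =
       wedge (wedge (\<lambda>vs. Complex (e 1 vs) (e 2 vs)) (\<lambda>vs. Complex (e 3 vs) (e 4 vs)))
         (\<lambda>vs. Complex (e 5 vs) (e 6 vs))"

text \<open>
  The model 3-form is $F \wedge e^7 + \Psi_+$ for the standard $SU(3)$-structure. The form
  $F \wedge e^7 - \Psi_-$ arises from it by multiplying $e^1 + i e^2$ by $i$, which changes
  neither the metric nor the orientation.
\<close>

definition g2_coframe :: "(nat \<Rightarrow> 'e::euclidean_space list \<Rightarrow> real) \<Rightarrow> ('e list \<Rightarrow> real) \<Rightarrow> bool" where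
  "g2_coframe e \<phi> \<longleftrightarrow> coframe 7 e \<and>
     \<phi> = (\<lambda>vs. ewedge e [1,2,7] vs + ewedge e [3,4,7] vs + ewedge e [5,6,7] vs
              + ewedge e [1,3,5] vs - ewedge e [1,4,6] vs - ewedge e [2,3,6] vs - ewedge e [2,4,5] vs)"

text \<open>
  The metric of a $G_2$-form makes the adapted coframes orthonormal, and its orientation makes them
  positive. Neither depends on the choice of adapted coframe, as the stabiliser of the model form is
  contained in $SO(7)$.
\<close>

definition g2_frame :: "('e::euclidean_space list \<Rightarrow> real) \<Rightarrow> nat \<Rightarrow> 'e list \<Rightarrow> real" where
  "g2_frame \<phi> = (SOME e. g2_coframe e \<phi>)"

definition g2_metric :: "('e::euclidean_space list \<Rightarrow> real) \<Rightarrow> 'e \<Rightarrow> 'e \<Rightarrow> real" where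
  "g2_metric \<phi> u v = (\<Sum>i=1..7. g2_frame \<phi> i [u] * g2_frame \<phi> i [v])"

definition g2_vol :: "('e::euclidean_space list \<Rightarrow> real) \<Rightarrow> 'e list \<Rightarrow> real" where
  "g2_vol \<phi> = ewedge (g2_frame \<phi>) [1,2,3,4,5,6,7]"

definition orthonormal_basis :: "('e::euclidean_space \<Rightarrow> 'e \<Rightarrow> real) \<Rightarrow> (nat \<Rightarrow> 'e) \<Rightarrow> bool" where
  "orthonormal_basis g b \<longleftrightarrow>
     (\<forall>i<DIM('e). \<forall>j<DIM('e). g (b i) (b j) = (if i = j then 1 else 0))"

text \<open>
  Hodge star of a metric \<open>g\<close> with volume form \<open>vol\<close>, by the index formula
  $(*\beta)_{j_1 \dots j_{n-k}} = \frac{1}{k!} \beta^{i_1 \dots i_k} \mathrm{vol}_{i_1 \dots i_k j_1 \dots j_{n-k}}$,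
  with the indices raised by means of an orthonormal basis (the result does not depend on which).
  It satisfies $\alpha \wedge *\beta = g(\alpha, \beta)\,\mathrm{vol}$.
\<close>

definition hodge_star ::
  "('e::euclidean_space \<Rightarrow> 'e \<Rightarrow> real) \<Rightarrow> ('e list \<Rightarrow> real) \<Rightarrow> ('e list \<Rightarrow> real) \<Rightarrow> 'e list \<Rightarrow> real" where
  "hodge_star g vol \<beta> vs =
     (let b = (SOME b. orthonormal_basis g b); k = DIM('e) - length vs
      in (\<Sum>is | set is \<subseteq> {..<DIM('e)} \<and> length is = k.
            \<beta> (map b is) * vol (map b is @ vs)) / fact k)"

definition g2_star :: "('e::euclidean_space list \<Rightarrow> real) \<Rightarrow> 'e list \<Rightarrow> real" where
  "g2_star \<phi> = hodge_star (g2_metric \<phi>) (g2_vol \<phi>) \<phi>"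


section \<open>Smooth manifolds and differential forms\<close>

text \<open>The predicates \<open>Ck\<close> and \<open>smooth_on\<close> are meant for open sets \<open>S\<close>.\<close>

primrec Ck :: "nat \<Rightarrow> 'e::real_normed_vector set \<Rightarrow> ('e \<Rightarrow> 'f::real_normed_vector) \<Rightarrow> bool" where
  "Ck 0 S f \<longleftrightarrow> continuous_on S f"
| "Ck (Suc n) S f \<longleftrightarrow>
     (\<forall>x\<in>S. f differentiable (at x)) \<and> (\<forall>v. Ck n S (\<lambda>x. frechet_derivative f (at x) v))"

definition smooth_on :: "'e::real_normed_vector set \<Rightarrow> ('e \<Rightarrow> 'f::real_normed_vector) \<Rightarrow> bool" where
  "smooth_on S f \<longleftrightarrow> (\<forall>n. Ck n S f)"

text \<open>
  A chart is a pair of its domain and its coordinate map (whose values off the domain are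
  irrelevant); a manifold is a topological space with a smooth atlas.
\<close>

type_synonym ('a, 'e) chart = "'a set \<times> ('a \<Rightarrow> 'e)"
type_synonym ('a, 'e) manifold = "'a topology \<times> ('a, 'e) chart set"

abbreviation dom_of :: "('a, 'e) chart \<Rightarrow> 'a set" where "dom_of c \<equiv> fst c"
abbreviation coord :: "('a, 'e) chart \<Rightarrow> 'a \<Rightarrow> 'e" where "coord c \<equiv> snd c"
abbreviation img_of :: "('a, 'e) chart \<Rightarrow> 'e set" where "img_of c \<equiv> coord c ` dom_of c"
abbreviation atlas :: "('a, 'e) manifold \<Rightarrow> ('a, 'e) chart set" where "atlas M \<equiv> snd M"

definition transition :: "('a, 'e) chart \<Rightarrow> ('a, 'e) chart \<Rightarrow> 'e \<Rightarrow> 'e" where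
  "transition c d = coord d \<circ> inv_into (dom_of c) (coord c)"

definition smooth_manifold :: "('a, 'e::euclidean_space) manifold \<Rightarrow> bool" where
  "smooth_manifold M \<longleftrightarrow>
     Hausdorff_space (fst M) \<and> second_countable (fst M) \<and>
     (\<Union>c\<in>atlas M. dom_of c) = topspace (fst M) \<and>
     (\<forall>c\<in>atlas M. openin (fst M) (dom_of c) \<and> open (img_of c) \<and>
        homeomorphic_map (subtopology (fst M) (dom_of c)) (top_of_set (img_of c)) (coord c)) \<and>
     (\<forall>c\<in>atlas M. \<forall>d\<in>atlas M. smooth_on (coord c ` (dom_of c \<inter> dom_of d)) (transition c d))"

text \<open>
  A differential form is given by its coordinate representatives, one for each chart, which
  are related by pullback along the transition maps: \<open>\<omega> c y\<close> is the covector at the point of the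
  manifold with coordinates \<open>y\<close> in the chart \<open>c\<close>. Only charts \<open>c\<close> of the atlas and points \<open>y\<close> in the
  image of \<open>c\<close> matter, and accordingly forms are compared by \<open>form_eq\<close>.
\<close>

type_synonym ('a, 'e) dform = "('a, 'e) chart \<Rightarrow> 'e \<Rightarrow> 'e list \<Rightarrow> real"

definition diff_form :: "('a, 'e::euclidean_space) manifold \<Rightarrow> nat \<Rightarrow> ('a, 'e) dform \<Rightarrow> bool" where
  "diff_form M k \<omega> \<longleftrightarrow>
     (\<forall>c\<in>atlas M. (\<forall>y\<in>img_of c. alt_form k (\<omega> c y)) \<and>
                  (\<forall>vs. smooth_on (img_of c) (\<lambda>y. \<omega> c y vs))) \<and>
     (\<forall>c\<in>atlas M. \<forall>d\<in>atlas M. \<forall>p\<in>dom_of c \<inter> dom_of d. \<forall>vs.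
        \<omega> c (coord c p) vs =
        \<omega> d (coord d p) (map (frechet_derivative (transition c d) (at (coord c p))) vs))"

definition form_eq :: "('a, 'e) manifold \<Rightarrow> ('a, 'e) dform \<Rightarrow> ('a, 'e) dform \<Rightarrow> bool" where
  "form_eq M \<alpha> \<beta> \<longleftrightarrow> (\<forall>c\<in>atlas M. \<forall>y\<in>img_of c. \<alpha> c y = \<beta> c y)"

text \<open>
  In coordinates,
  $d\omega(v_0, \dots, v_k) = \sum_i (-1)^i D_{v_i}(\omega(v_0, \dots, \widehat{v_i}, \dots, v_k))$
  for constant vector fields $v_i$.
\<close>

definition ext_d :: "('a, 'e::euclidean_space) dform \<Rightarrow> ('a, 'e) dform" where
  "ext_d \<omega> c y vs =
     (\<Sum>i<length vs. (-1) ^ i *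
        frechet_derivative (\<lambda>z. \<omega> c z (take i vs @ drop (Suc i) vs)) (at y) (vs ! i))"


section \<open>\<open>SU(3)\<close>-structures on 6-manifolds\<close>

definition su3_structure ::
  "('a, real^6) manifold \<Rightarrow> ('a, real^6) dform \<Rightarrow> ('a, real^6) dform \<Rightarrow> ('a, real^6) dform \<Rightarrow> bool" where
  "su3_structure M F P N \<longleftrightarrow>
     diff_form M 2 F \<and> diff_form M 3 P \<and> diff_form M 3 N \<and>
     (\<forall>c\<in>atlas M. \<forall>y\<in>img_of c. \<exists>V e. open V \<and> y \<in> V \<and> V \<subseteq> img_of c \<and>
        (\<forall>i\<in>{1..6}. \<forall>v. smooth_on V (\<lambda>x. e i x [v])) \<and>
        (\<forall>x\<in>V. su3_coframe (\<lambda>i. e i x) (F c x) (P c x) (N c x)))"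

definition nearly_half_flat ::
  "('a, real^6) manifold \<Rightarrow> ('a, real^6) dform \<Rightarrow> ('a, real^6) dform \<Rightarrow> ('a, real^6) dform \<Rightarrow> bool" where
  "nearly_half_flat M F P N \<longleftrightarrow> su3_structure M F P N \<and>
     form_eq M (ext_d N) (\<lambda>c y vs. - 2 * wedge (F c y) (F c y) vs)"

text \<open>
  A family of structures depends smoothly on \<open>q\<close> if the adapted coframe can locally, near each
  point and each value of \<open>q\<close>, be chosen smooth in the point and \<open>q\<close> jointly. The three forms
  are then jointly smooth, too.
\<close>

definition su3_family ::
  "('a, real^6) manifold \<Rightarrow> (real \<Rightarrow> ('a, real^6) dform) \<Rightarrow> (real \<Rightarrow> ('a, real^6) dform) \<Rightarrow>
     (real \<Rightarrow> ('a, real^6) dform) \<Rightarrow> bool" where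
  "su3_family M F P N \<longleftrightarrow>
     (\<forall>q. su3_structure M (F q) (P q) (N q)) \<and>
     (\<forall>c\<in>atlas M. \<forall>y\<in>img_of c. \<forall>q0. \<exists>V I e.
        open V \<and> y \<in> V \<and> V \<subseteq> img_of c \<and> open I \<and> q0 \<in> I \<and>
        (\<forall>i\<in>{1..6}. \<forall>v. smooth_on (V \<times> I) (\<lambda>(x, q). e i q x [v])) \<and>
        (\<forall>x\<in>V. \<forall>q\<in>I. su3_coframe (\<lambda>i. e i q x) (F q c x) (P q c x) (N q c x)))"

definition initial_value ::
  "('a, 'e) manifold \<Rightarrow> (real \<Rightarrow> ('a, 'e) dform) \<Rightarrow> ('a, 'e) dform \<Rightarrow> bool" where
  "initial_value M \<alpha> \<alpha>0 \<longleftrightarrow> form_eq M (\<alpha> 0) \<alpha>0"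

definition d_dq :: "(real \<Rightarrow> ('a, 'e) dform) \<Rightarrow> real \<Rightarrow> ('a, 'e) dform" where
  "d_dq \<alpha> q c y vs = deriv (\<lambda>s. \<alpha> s c y vs) q"

definition nearly_half_flat_evolution ::
  "('a, real^6) manifold \<Rightarrow> (real \<Rightarrow> ('a, real^6) dform) \<Rightarrow> (real \<Rightarrow> ('a, real^6) dform) \<Rightarrow>
     (real \<Rightarrow> ('a, real^6) dform) \<Rightarrow> bool" where
  "nearly_half_flat_evolution M F P N \<longleftrightarrow>
     (\<forall>q. form_eq M (d_dq N q) (\<lambda>c y vs. 4 * P q c y vs - ext_d (F q) c y vs) \<and>
          form_eq M (ext_d (P q))
            (\<lambda>c y vs. - (1/2) * d_dq (\<lambda>s c y. wedge (F s c y) (F s c y)) q c y vs))"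


section \<open>The cylinder and nearly parallel \<open>G\<^sub>2\<close>-structures\<close>

definition cyl_chart :: "('a, 'e) chart \<Rightarrow> ('a \<times> real, 'e \<times> real) chart" where
  "cyl_chart c = (dom_of c \<times> UNIV, \<lambda>(p, q). (coord c p, q))"

definition cylinder :: "('a, 'e) manifold \<Rightarrow> ('a \<times> real, 'e \<times> real) manifold" where
  "cylinder M = (prod_topology (fst M) euclideanreal, cyl_chart ` atlas M)"

text \<open>Left inverse of \<open>cyl_chart\<close>; it says to which chart of \<open>M\<close> a chart of the cylinder belongs.\<close>

definition base_chart :: "('a \<times> real, 'e \<times> real) chart \<Rightarrow> ('a, 'e) chart" where
  "base_chart d = (fst ` dom_of d, \<lambda>p. fst (coord d (p, 0)))"

lemma base_chart_cyl_chart: "base_chart (cyl_chart c) = c"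
  by (cases c) (auto simp: base_chart_def cyl_chart_def image_iff)

text \<open>
  A family \<open>\<alpha>(q)\<close> of forms on \<open>M\<close> regarded as a form on the cylinder, whose value at \<open>(p, q)\<close> is
  the pullback of \<open>\<alpha>(q)\<close> along the projection to \<open>M\<close>.
\<close>

definition cyl_form :: "(real \<Rightarrow> ('a, 'e) dform) \<Rightarrow> ('a \<times> real, 'e \<times> real) dform" where
  "cyl_form \<alpha> d z vs = \<alpha> (snd z) (base_chart d) (fst z) (map fst vs)"

definition dq :: "('a \<times> real, 'e \<times> real) dform" where
  "dq d z vs = (case vs of [v] \<Rightarrow> snd v | _ \<Rightarrow> 0)"

definition lift_form ::
  "(real \<Rightarrow> ('a, real^6) dform) \<Rightarrow> (real \<Rightarrow> ('a, real^6) dform) \<Rightarrow> ('a \<times> real, (real^6) \<times> real) dform" where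
  "lift_form F N d z vs = wedge (cyl_form F d z) (dq d z) vs - cyl_form N d z vs"

definition g2_structure :: "('a, 'e::euclidean_space) manifold \<Rightarrow> ('a, 'e) dform \<Rightarrow> bool" where
  "g2_structure M \<phi> \<longleftrightarrow>
     diff_form M 3 \<phi> \<and>
     (\<forall>c\<in>atlas M. \<forall>y\<in>img_of c. \<exists>V e. open V \<and> y \<in> V \<and> V \<subseteq> img_of c \<and>
        (\<forall>i\<in>{1..7}. \<forall>v. smooth_on V (\<lambda>x. e i x [v])) \<and>
        (\<forall>x\<in>V. g2_coframe (\<lambda>i. e i x) (\<phi> c x)))"

definition nearly_parallel_g2 :: "('a, 'e::euclidean_space) manifold \<Rightarrow> ('a, 'e) dform \<Rightarrow> bool" where
  "nearly_parallel_g2 M \<phi> \<longleftrightarrow> g2_structure M \<phi> \<and>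
     form_eq M (ext_d \<phi>) (\<lambda>c y vs. 4 * g2_star (\<phi> c y) vs)"

end

theory Submission
  imports Defs
begin

text \<open>
  Write $d\phi$ and ${*}\phi$ for $\phi = F \wedge dq - \Psi_-$ on the cylinder in terms of data on \<open>M\<close>:
  $d\phi = (dF + \partial_q\Psi_-) \wedge dq - d\Psi_-$ and
  ${*}\phi = \frac12 F \wedge F + \Psi_+ \wedge dq$. Comparing the terms with and without \<open>dq\<close>,
  $d\phi = 4{*}\phi$ says that for all \<open>q\<close>
  \[ (1)\quad \partial_q\Psi_- = 4\Psi_+ - dF, \qquad (2)\quad d\Psi_- = -2 F \wedge F \]
  (\<open>nearly_parallel_lift_form_iff\<close>). The first equation is an evolution equation already. Given (1),
  applying \<open>d\<close> to it and using $d^2 = 0$ and $d\,\partial_q = \partial_q\,d$ yields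
  $\partial_q\,d\Psi_- = 4\,d\Psi_+$ (\<open>evolution_derivative\<close>). Hence the second evolution equation
  $d\Psi_+ = -\frac12\partial_q(F \wedge F)$ says precisely that $d\Psi_- + 2F \wedge F$ does not
  depend on \<open>q\<close>, so that together with (1) it propagates (2) from $q = 0$, where (2) is the nearly half
  flat condition, to all \<open>q\<close> (\<open>nearly_parallel_iff_evolution\<close>).
  
  Two points need work. One is the formula for ${*}\phi$. The star is formed with a metric and a volume
  form that come from an arbitrarily chosen coframe adapted to $\phi$, so they have to be shown to depend
  on $\phi$ only. In any adapted coframe
  $\iota_u\phi \wedge \iota_u\phi \wedge \phi = 6\,g(u,u)\,\mathrm{vol}$ (\<open>g2_volume_identity\<close>);
  forms of degree 7 are proportional, so two metrics of $\phi$ differ by a constant factor \<open>c\<close>. The cross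
  product, which $\phi$ and \<open>g\<close> determine, satisfies $|u \times v|^2 = |u|^2|v|^2 - g(u,v)^2$, and this
  forces $c^3 = 1$ (\<open>g2_metric_unique\<close>). The 4-form $\psi$ that is dual to $\phi$ in one adapted coframe is
  $\psi(u,v,w,z) = g(u \times v, w \times z) - g(u,w)g(v,z) + g(u,z)g(v,w)$
  (\<open>g2_contraction_identity\<close>), so it is the same in all of them, and evaluating the index formula of
  the star in the chosen coframe gives ${*}\phi = \psi$ (\<open>g2_star_eq\<close>).
  
  The other point is calculus on a chart: the forms of the family are jointly smooth in the point and
  \<open>q\<close> because they are polynomials in the coframes, and second derivatives of smooth functions are
  symmetric (\<open>frechet_derivative_symmetric\<close>), which is behind both $d^2 = 0$ and
  $d\,\partial_q = \partial_q\,d$.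
\<close>

section \<open>Wedge products on explicit lists\<close>

text \<open>
  Vanishing in all other degrees makes the sign in the recursion for wedge products a constant. Unlike
  \<open>alt_form\<close>, the notion applies to the complex-valued forms that define $\Psi_+ + i\Psi_-$, too.
\<close>

definition of_degree :: "nat \<Rightarrow> ('e list \<Rightarrow> 'r::zero) \<Rightarrow> bool" where
  "of_degree k \<alpha> \<longleftrightarrow> (\<forall>xs. length xs \<noteq> k \<longrightarrow> \<alpha> xs = 0)"

lemma wedge_Nil [simp]: "wedge \<alpha> \<beta> [] = \<alpha> [] * \<beta> []"
  by (simp add: wedge_def)

text \<open>
  The first vector goes either to \<open>\<alpha>\<close>, which creates no inversion, or to \<open>\<beta>\<close>, which creates one
  inversion for each vector that goes to \<open>\<alpha>\<close>. With this recursion in place of the sum over shuffles, the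
  simplifier can evaluate wedge products on explicit lists.
\<close>

lemma wedge_Cons:
  fixes \<alpha> \<beta> :: "'e list \<Rightarrow> 'r::comm_ring_1"
  shows "wedge \<alpha> \<beta> (v # vs) =
    wedge (\<lambda>xs. \<alpha> (v # xs)) \<beta> vs + wedge (\<lambda>xs. (-1) ^ length xs * \<alpha> xs) (\<lambda>xs. \<beta> (v # xs)) vs"
proof -
  define n where "n = length vs"
  define inv where "inv m I = {(i, j). i \<in> I \<and> j \<in> {..<m} - I \<and> j < i}" for m :: nat and I
  have fin: "finite (inv m I)" if "finite I" for m I
    by (rule finite_subset[of _ "I \<times> {..<m}"]) (auto simp: inv_def that)
  define f where "f I = (-1) ^ card (inv (Suc n) I) * \<alpha> (nths (v # vs) I) * \<beta> (nths (v # vs) (- I))" for I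
  \<comment> \<open>Split the sets of positions into those without 0 and those with 0; removing 0 and shifting
    down by one leaves an arbitrary set of positions in \<open>vs\<close>.\<close>
  have lhs: "wedge \<alpha> \<beta> (v # vs) = (\<Sum>I \<in> Pow {..<Suc n}. f I)"
    by (simp add: wedge_def f_def inv_def n_def)
  have Pow: "Pow {..<Suc n} = (`) Suc ` Pow {..<n} \<union> insert 0 ` (`) Suc ` Pow {..<n}"
    by (simp add: lessThan_Suc_eq_insert_0 Pow_insert image_Pow_surj)
  have injS: "inj_on ((`) Suc) A" for A
    by (simp add: inj_on_def inj_image_eq_iff)
  have injmap: "inj_on (map_prod Suc Suc) A" for A
    by (auto simp: inj_on_def)
  have inj0: "inj_on (insert 0) ((`) Suc ` Pow {..<n})"
    by (auto simp: inj_on_def)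
  have "(\<Sum>I \<in> Pow {..<Suc n}. f I) =
      (\<Sum>I \<in> (`) Suc ` Pow {..<n}. f I) + (\<Sum>I \<in> insert 0 ` (`) Suc ` Pow {..<n}. f I)"
    unfolding Pow by (rule sum.union_disjoint) auto
  also have "\<dots> = (\<Sum>I \<in> Pow {..<n}. f (Suc ` I)) + (\<Sum>I \<in> Pow {..<n}. f (insert 0 (Suc ` I)))"
    by (simp add: sum.reindex injS inj0)
  also have "(\<Sum>I \<in> Pow {..<n}. f (insert 0 (Suc ` I))) = wedge (\<lambda>xs. \<alpha> (v # xs)) \<beta> vs"
    unfolding wedge_def
  proof (intro sum.cong)
    fix I assume "I \<in> Pow {..<length vs}"
    have "inv (Suc n) (insert 0 (Suc ` I)) = map_prod Suc Suc ` inv n I"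
      by (auto simp: inv_def image_iff less_Suc_eq_0_disj)
    hence "card (inv (Suc n) (insert 0 (Suc ` I))) = card (inv n I)"
      by (simp add: card_image[OF injmap])
    moreover have "{j. Suc j \<notin> Suc ` I} = - I" "{j. j \<in> I} = I" by auto
    ultimately show "f (insert 0 (Suc ` I)) =
        (-1) ^ card {(i, j). i \<in> I \<and> j \<in> {..<length vs} - I \<and> j < i} *
        \<alpha> (v # nths vs I) * \<beta> (nths vs (- I))"
      by (simp add: f_def nths_Cons inv_def n_def image_iff)
  qed (simp add: n_def)
  also have "(\<Sum>I \<in> Pow {..<n}. f (Suc ` I)) =
      wedge (\<lambda>xs. (-1) ^ length xs * \<alpha> xs) (\<lambda>xs. \<beta> (v # xs)) vs"
    unfolding wedge_def
  proof (intro sum.cong)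
    fix I assume I: "I \<in> Pow {..<length vs}"
    hence finI: "finite I" using finite_subset by auto
    have "inv (Suc n) (Suc ` I) = map_prod Suc Suc ` inv n I \<union> (\<lambda>i. (Suc i, 0)) ` I"
      by (auto simp: inv_def image_iff less_Suc_eq_0_disj)
    hence "card (inv (Suc n) (Suc ` I)) = card (map_prod Suc Suc ` inv n I) + card ((\<lambda>i. (Suc i, 0::nat)) ` I)"
      using finI fin[OF finI] by (subst card_Un_disjoint[symmetric]) auto
    also have "\<dots> = card (inv n I) + card I"
      by (simp add: card_image[OF injmap] card_image inj_on_def)
    also have "card I = length (nths vs I)"
      using I by (auto simp: length_nths intro!: arg_cong[of _ _ card])
    finally have "card (inv (Suc n) (Suc ` I)) = card (inv n I) + length (nths vs I)" .
    moreover have "{j. Suc j \<notin> Suc ` I} = - I" "{j. j \<in> I} = I" by auto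
    ultimately show "f (Suc ` I) =
        (-1) ^ card {(i, j). i \<in> I \<and> j \<in> {..<length vs} - I \<and> j < i} *
        ((-1) ^ length (nths vs I) * \<alpha> (nths vs I)) * \<beta> (v # nths vs (- I))"
      by (simp add: f_def nths_Cons inv_def n_def image_iff power_add)
  qed (simp add: n_def)
  finally show ?thesis by (simp add: lhs add.commute)
qed

lemma wedge_eq_0:
  assumes "of_degree k \<alpha>" "of_degree l \<beta>" "length vs \<noteq> k + l"
  shows "wedge \<alpha> \<beta> vs = 0"
proof -
  have "\<alpha> (nths vs I) * \<beta> (nths vs (- I)) = 0" for I
  proof -
    have "length (nths vs I) + length (nths vs (- I)) = length vs"
    proof (induction vs arbitrary: I)
      case (Cons a vs)
      have "{j. Suc j \<notin> I} = - {j. Suc j \<in> I}" by auto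
      with Cons[of "{j. Suc j \<in> I}"] show ?case by (simp add: nths_Cons)
    qed simp
    with assms(3) have "length (nths vs I) \<noteq> k \<or> length (nths vs (- I)) \<noteq> l" by linarith
    thus ?thesis using assms(1,2) unfolding of_degree_def by auto
  qed
  thus ?thesis unfolding wedge_def by (simp add: mult.assoc)
qed

lemma of_degree_wedge: "of_degree k \<alpha> \<Longrightarrow> of_degree l \<beta> \<Longrightarrow> of_degree (k + l) (wedge \<alpha> \<beta>)"
  using wedge_eq_0[of k \<alpha> l \<beta>] unfolding of_degree_def[of "k + l"] by blast

lemma wedge_zero_left [simp]: "wedge (\<lambda>_. 0) \<beta> = (\<lambda>_. 0)"
  by (simp add: wedge_def fun_eq_iff)

lemma wedge_zero_right [simp]: "wedge \<alpha> (\<lambda>_. 0) = (\<lambda>_. 0)"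
  by (simp add: wedge_def fun_eq_iff)

lemma wedge_add_left: "wedge (\<lambda>xs. \<alpha> xs + \<alpha>' xs) \<beta> vs = wedge \<alpha> \<beta> vs + wedge \<alpha>' \<beta> vs"
  by (simp add: wedge_def algebra_simps sum.distrib)

lemma wedge_add_right: "wedge \<alpha> (\<lambda>xs. \<beta> xs + \<beta>' xs) vs = wedge \<alpha> \<beta> vs + wedge \<alpha> \<beta>' vs"
  by (simp add: wedge_def algebra_simps sum.distrib)

lemma wedge_scale_left: "wedge (\<lambda>xs. c * \<alpha> xs) \<beta> vs = c * wedge \<alpha> \<beta> vs"
  by (simp add: wedge_def sum_distrib_left algebra_simps)

lemma wedge_scale_right: "wedge \<alpha> (\<lambda>xs. c * \<beta> xs) vs = c * wedge \<alpha> \<beta> vs"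
  by (simp add: wedge_def sum_distrib_left algebra_simps)

lemma wedge_degree_0:
  assumes "of_degree 0 \<alpha>"
  shows "wedge \<alpha> \<beta> vs = \<alpha> [] * \<beta> vs"
proof (induction vs arbitrary: \<beta>)
  case (Cons v vs)
  have "\<alpha> (v # xs) = 0" "(-1) ^ length xs * \<alpha> xs = \<alpha> xs" for xs
    using assms by (cases xs; simp add: of_degree_def)+
  thus ?case by (simp add: wedge_Cons Cons)
qed simp

lemma of_degree_Cons: "of_degree (Suc k) \<alpha> \<Longrightarrow> of_degree k (\<lambda>xs. \<alpha> (v # xs))"
  by (simp add: of_degree_def)

lemma wedge_1_Cons:
  fixes \<alpha> :: "'e list \<Rightarrow> 'r::comm_ring_1"
  assumes "of_degree 1 \<alpha>"
  shows "wedge \<alpha> \<beta> (v # vs) = \<alpha> [v] * \<beta> vs - wedge \<alpha> (\<lambda>xs. \<beta> (v # xs)) vs"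
proof -
  have "(-1) ^ length xs * \<alpha> xs = (-1) * \<alpha> xs" for xs
    using assms by (cases "length xs = 1"; simp add: of_degree_def)
  moreover have "of_degree 0 (\<lambda>xs. \<alpha> (v # xs))"
    using assms of_degree_Cons[of 0] by simp
  ultimately show ?thesis
    by (simp only: wedge_Cons wedge_degree_0 wedge_scale_left) simp
qed

lemma wedge_2_Cons:
  fixes \<alpha> :: "'e list \<Rightarrow> 'r::comm_ring_1"
  assumes "of_degree 2 \<alpha>"
  shows "wedge \<alpha> \<beta> (v # vs) = wedge (\<lambda>xs. \<alpha> (v # xs)) \<beta> vs + wedge \<alpha> (\<lambda>xs. \<beta> (v # xs)) vs"
proof -
  have "(-1) ^ length xs * \<alpha> xs = \<alpha> xs" for xs
    using assms by (cases "length xs = 2"; simp add: of_degree_def)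
  thus ?thesis by (simp only: wedge_Cons)
qed

section \<open>Alternating forms\<close>

lemma alt_form_of_degree: "alt_form k \<omega> \<Longrightarrow> of_degree k \<omega>"
  by (simp add: alt_form_def of_degree_def)

lemma alt_form_eq_0: "alt_form k \<omega> \<Longrightarrow> length vs \<noteq> k \<Longrightarrow> \<omega> vs = 0"
  by (simp add: alt_form_def)

lemma alt_form_not_distinct: "alt_form k \<omega> \<Longrightarrow> \<not> distinct vs \<Longrightarrow> \<omega> vs = 0"
  by (cases "length vs = k") (auto simp: alt_form_def)

lemma alt_form_linear_update:
  "alt_form k \<omega> \<Longrightarrow> i < length vs \<Longrightarrow> length vs = k \<Longrightarrow> linear (\<lambda>v. \<omega> (vs[i := v]))"
  by (simp add: alt_form_def)

lemma alt_form_linear: "alt_form k \<omega> \<Longrightarrow> linear (\<lambda>v. \<omega> (xs @ v # ys))"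
proof (cases "Suc (length xs + length ys) = k")
  case True
  assume "alt_form k \<omega>"
  from alt_form_linear_update[OF this, of "length xs" "xs @ 0 # ys"] True
  show ?thesis by simp
next
  case False
  assume "alt_form k \<omega>"
  thus ?thesis using False by (simp add: alt_form_eq_0 linear_zero module_hom_zero)
qed

lemma alt_form_linear_Cons: "alt_form k \<omega> \<Longrightarrow> linear (\<lambda>v. \<omega> (v # ys))"
  using alt_form_linear[of k \<omega> "[]"] by simp

lemma alt_form_swap:
  assumes "alt_form k \<omega>"
  shows "\<omega> (xs @ u # ys @ v # zs) = - \<omega> (xs @ v # ys @ u # zs)"
proof -
  have l1: "linear (\<lambda>w. \<omega> (xs @ w # ys @ y # zs))" for y
    by (rule alt_form_linear[OF assms])
  have l2: "linear (\<lambda>w. \<omega> (xs @ y # ys @ w # zs))" for y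
    using alt_form_linear[OF assms, of "xs @ y # ys"] by simp
  have z: "\<omega> (xs @ y # ys @ y # zs) = 0" for y
    by (rule alt_form_not_distinct[OF assms]) simp
  have "\<omega> (xs @ (u + v) # ys @ (u + v) # zs) = 
     \<omega> (xs @ u # ys @ u # zs) + \<omega> (xs @ u # ys @ v # zs)
     + (\<omega> (xs @ v # ys @ u # zs) + \<omega> (xs @ v # ys @ v # zs))"
    using linear_add[OF l1, of u v "u + v"] linear_add[OF l2, of _ u v] by simp
  thus ?thesis using z by simp
qed

lemma alt_form_Cons: "alt_form (Suc k) \<omega> \<Longrightarrow> alt_form k (\<lambda>xs. \<omega> (v # xs))"
  unfolding alt_form_def
proof (intro conjI allI impI; elim conjE)
  fix vs :: "'a list" and i
  assume *: "\<forall>vs i. length vs = Suc k \<and> i < Suc k \<longrightarrow> linear (\<lambda>v. \<omega> (vs[i := v]))"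
    and i: "length vs = k" "i < k"
  from *[rule_format, of "v # vs" "Suc i"] i
  show "linear (\<lambda>va. \<omega> (v # vs[i := va]))" by simp
qed auto

text \<open>
  Alternation needs to be checked on the first two slots only, as long as the contractions with a
  first vector are alternating already: a repeated vector can be moved next to the first one.
\<close>

lemma alt_formI_Cons:
  fixes \<omega> :: "'e::real_vector list \<Rightarrow> real"
  assumes nil: "\<omega> [] = 0"
    and tail: "\<And>v. alt_form k (\<lambda>xs. \<omega> (v # xs))"
    and lin: "\<And>xs. length xs = k \<Longrightarrow> linear (\<lambda>v. \<omega> (v # xs))"
    and alt: "\<And>v xs. Suc (length xs) = k \<Longrightarrow> \<omega> (v # v # xs) = 0"
  shows "alt_form (Suc k) \<omega>"
  unfolding alt_form_def
proof (intro conjI allI impI)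
  fix vs :: "'e list" assume "length vs \<noteq> Suc k"
  thus "\<omega> vs = 0" using nil alt_form_eq_0[OF tail] by (cases vs) auto
next
  fix vs :: "'e list" and i assume "length vs = Suc k \<and> i < Suc k"
  thus "linear (\<lambda>v. \<omega> (vs[i := v]))"
    using lin alt_form_linear_update[OF tail] by (cases vs; cases i) auto
next
  fix vs :: "'e list" assume vs: "length vs = Suc k \<and> \<not> distinct vs"
  then obtain v ws where ws: "vs = v # ws" "length ws = k" by (cases vs) auto
  show "\<omega> vs = 0"
  proof (cases "distinct ws")
    case False
    thus ?thesis using ws alt_form_not_distinct[OF tail] by auto
  next
    case True
    with vs ws have "v \<in> set ws" by simp
    then obtain xs ys where sp: "ws = xs @ v # ys" by (meson split_list)
    show ?thesis
    proof (cases xs)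
      case Nil
      thus ?thesis using ws sp alt by simp
    next
      case (Cons x xs')
      have "\<omega> (v # x # xs' @ v # ys) = - \<omega> (v # v # xs' @ x # ys)"
        using alt_form_swap[OF tail[of v], of "[]" x xs' v ys] by simp
      thus ?thesis using ws sp Cons alt by simp
    qed
  qed
qed

lemma alt_form_zero [simp]: "alt_form k (\<lambda>_. 0)"
  by (simp add: alt_form_def linear_zero module_hom_zero)

lemma alt_form_add: "alt_form k \<alpha> \<Longrightarrow> alt_form k \<beta> \<Longrightarrow> alt_form k (\<lambda>xs. \<alpha> xs + \<beta> xs)"
  unfolding alt_form_def by (auto intro: linear_compose_add)

lemma alt_form_scale: "alt_form k \<alpha> \<Longrightarrow> alt_form k (\<lambda>xs. c * \<alpha> xs)"
  unfolding alt_form_def by (auto intro!: linear_compose_scale_right[where 'b=real, simplified])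

lemma alt_form_diff: "alt_form k \<alpha> \<Longrightarrow> alt_form k \<beta> \<Longrightarrow> alt_form k (\<lambda>xs. \<alpha> xs - \<beta> xs)"
  unfolding alt_form_def by (auto intro: linear_compose_sub)

lemma alt_form_sign: "alt_form k \<alpha> \<Longrightarrow> alt_form k (\<lambda>xs. (-1) ^ length xs * \<alpha> xs)"
proof -
  assume a: "alt_form k \<alpha>"
  hence "(\<lambda>xs. (-1) ^ length xs * \<alpha> xs) = (\<lambda>xs. (-1) ^ k * \<alpha> xs)"
    by (intro ext) (metis alt_form_eq_0 mult_zero_right)
  thus ?thesis using alt_form_scale[OF a] by simp
qed

lemma linear_wedge_left:
  assumes "\<And>xs. linear (\<lambda>v. \<alpha> v xs)"
  shows "linear (\<lambda>v. wedge (\<alpha> v) \<beta> vs :: real)"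
proof (rule linearI)
  fix u v
  have "\<alpha> (u + v) = (\<lambda>xs. \<alpha> u xs + \<alpha> v xs)"
    by (intro ext linear_add[OF assms])
  thus "wedge (\<alpha> (u + v)) \<beta> vs = wedge (\<alpha> u) \<beta> vs + wedge (\<alpha> v) \<beta> vs"
    by (simp only: wedge_add_left)
next
  fix c v
  have "\<alpha> (c *\<^sub>R v) = (\<lambda>xs. c * \<alpha> v xs)"
    using linear_scale[OF assms] by (intro ext) auto
  thus "wedge (\<alpha> (c *\<^sub>R v)) \<beta> vs = c *\<^sub>R wedge (\<alpha> v) \<beta> vs"
    by (simp only: wedge_scale_left real_scaleR_def)
qed

lemma linear_wedge_right:
  assumes "\<And>xs. linear (\<lambda>v. \<beta> v xs)"
  shows "linear (\<lambda>v. wedge \<alpha> (\<beta> v) vs :: real)"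
proof (rule linearI)
  fix u v
  have "\<beta> (u + v) = (\<lambda>xs. \<beta> u xs + \<beta> v xs)"
    by (intro ext linear_add[OF assms])
  thus "wedge \<alpha> (\<beta> (u + v)) vs = wedge \<alpha> (\<beta> u) vs + wedge \<alpha> (\<beta> v) vs"
    by (simp only: wedge_add_right)
next
  fix c v
  have "\<beta> (c *\<^sub>R v) = (\<lambda>xs. c * \<beta> v xs)"
    using linear_scale[OF assms] by (intro ext) auto
  thus "wedge \<alpha> (\<beta> (c *\<^sub>R v)) vs = c *\<^sub>R wedge \<alpha> (\<beta> v) vs"
    by (simp only: wedge_scale_right real_scaleR_def)
qed

lemma alt_form_0_iff: "alt_form 0 \<omega> \<longleftrightarrow> of_degree 0 \<omega>"
  by (auto simp: alt_form_def of_degree_def)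

text \<open>
  The induction peels off the first vector: its two possible destinations, the two factors, give
  wedge products of forms of smaller degree, and for two equal leading vectors the two mixed terms
  cancel.
\<close>

lemma alt_form_wedge:
  assumes "alt_form k \<alpha>" "alt_form l \<beta>"
  shows "alt_form (k + l) (wedge \<alpha> \<beta>)"
  using assms
proof (induction "k + l" arbitrary: k l \<alpha> \<beta>)
  case 0
  thus ?case using of_degree_wedge[of 0 \<alpha> 0 \<beta>] by (simp add: alt_form_0_iff)
next
  case (Suc n)
  have tailz: "(\<lambda>xs. \<gamma> (v # xs)) = (\<lambda>_. 0)" if "alt_form 0 \<gamma>" for v and \<gamma> :: "'a list \<Rightarrow> real"
    using that by (simp add: alt_form_eq_0)
  have "alt_form (Suc n) (wedge \<alpha> \<beta>)"
  proof (rule alt_formI_Cons)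
    show "wedge \<alpha> \<beta> [] = 0"
      using wedge_eq_0[OF alt_form_of_degree[OF Suc.prems(1)] alt_form_of_degree[OF Suc.prems(2)], of "[]"]
      by (simp add: Suc.hyps(2)[symmetric] del: wedge_Nil)
  next
    fix v
    have "alt_form n (wedge (\<lambda>xs. \<alpha> (v # xs)) \<beta>)"
    proof (cases k)
      case 0 thus ?thesis using Suc.prems tailz by simp
    next
      case (Suc k')
      thus ?thesis using Suc.hyps(1)[of k' l "\<lambda>xs. \<alpha> (v # xs)" \<beta>] Suc.hyps(2) Suc.prems alt_form_Cons by auto
    qed
    moreover have "alt_form n (wedge (\<lambda>xs. (-1) ^ length xs * \<alpha> xs) (\<lambda>xs. \<beta> (v # xs)))"
    proof (cases l)
      case 0 
      thus ?thesis using Suc.prems tailz 0 by simp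
    next
      case (Suc l')
      hence "alt_form l' (\<lambda>xs. \<beta> (v # xs))" using Suc.prems alt_form_Cons by blast
      from Suc.hyps(1)[OF _ alt_form_sign[OF Suc.prems(1)] this] Suc.hyps(2) Suc
      show ?thesis by simp
    qed
    ultimately show "alt_form n (\<lambda>xs. wedge \<alpha> \<beta> (v # xs))"
      unfolding wedge_Cons by (rule alt_form_add)
  next
    fix xs :: "'a list"
    show "linear (\<lambda>v. wedge \<alpha> \<beta> (v # xs))"
      unfolding wedge_Cons
      by (intro linear_compose_add linear_wedge_left linear_wedge_right alt_form_linear_Cons[OF Suc.prems(1)]
          alt_form_linear_Cons[OF Suc.prems(2)])
  next
    fix v :: 'a and xs :: "'a list"
    have "\<alpha> (v # v # ys) = 0" "\<beta> (v # v # ys) = 0" for ys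
      using Suc.prems by (auto intro: alt_form_not_distinct)
    moreover have "wedge (\<lambda>xs. - (((-1) ^ length xs) * \<alpha> (v # xs))) (\<lambda>xs. \<beta> (v # xs)) xs
        = - wedge (\<lambda>xs. ((-1) ^ length xs) * \<alpha> (v # xs)) (\<lambda>xs. \<beta> (v # xs)) xs"
      using wedge_scale_left[of "-1"] by simp
    ultimately show "wedge \<alpha> \<beta> (v # v # xs) = 0"
      by (simp add: wedge_Cons)
  qed
  thus ?case using Suc(2) by simp
qed

lemma alt_form_move_front:
  assumes "alt_form k \<omega>"
  shows "\<omega> (xs @ a # ys) = (-1) ^ length xs * \<omega> (a # xs @ ys)"
  using assms
proof (induction xs arbitrary: k \<omega>)
  case (Cons x xs)
  show ?case
  proof (cases k)
    case 0
    thus ?thesis using Cons.prems by (simp add: alt_form_eq_0)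
  next
    case (Suc k')
    have "\<omega> ((x # xs) @ a # ys) = (-1) ^ length xs * \<omega> (x # a # xs @ ys)"
      using Cons.IH[of k' "\<lambda>xs. \<omega> (x # xs)"] alt_form_Cons Cons.prems Suc by auto
    also have "\<omega> (x # a # xs @ ys) = - \<omega> (a # x # xs @ ys)"
      using alt_form_swap[OF Cons.prems, of "[]" x "[]" a] by simp
    finally show ?thesis by simp
  qed
qed simp

text \<open>
  Moving an argument to the front changes at most the sign. So whether a form vanishes on some vectors
  does not depend on their order.
\<close>

lemma alt_form_abs_mset:
  assumes "alt_form k \<omega>" "mset xs = mset ys"
  shows "\<bar>\<omega> xs\<bar> = \<bar>\<omega> ys\<bar>"
  using assms
proof (induction xs arbitrary: ys k \<omega>)
  case (Cons x xs)
  obtain ys1 ys2 where ys: "ys = ys1 @ x # ys2"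
    using Cons.prems(2) by (metis list.set_intros(1) set_mset_mset split_list)
  show ?case
  proof (cases k)
    case 0
    thus ?thesis using Cons.prems ys by (simp add: alt_form_eq_0)
  next
    case (Suc k')
    have "mset xs = mset (ys1 @ ys2)" using Cons.prems(2) ys by simp
    moreover have "alt_form k' (\<lambda>xs. \<omega> (x # xs))"
      using Cons.prems(1) Suc alt_form_Cons by blast
    ultimately have "\<bar>\<omega> (x # xs)\<bar> = \<bar>\<omega> (x # ys1 @ ys2)\<bar>" by (intro Cons.IH)
    also have "\<dots> = \<bar>\<omega> ys\<bar>"
      using alt_form_move_front[OF Cons.prems(1), of ys1 x ys2] ys by (simp add: abs_mult)
    finally show ?thesis .
  qed
qed simp

section \<open>Coframes and their dual bases\<close>

text \<open>
  That \<open>b\<close> is a basis is recorded as the expansion of a vector in it, whose coefficients are the values of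
  the \<open>e i\<close>.
\<close>

definition dual_basis :: "nat \<Rightarrow> (nat \<Rightarrow> 'e::euclidean_space list \<Rightarrow> real) \<Rightarrow> (nat \<Rightarrow> 'e) \<Rightarrow> bool" where
  "dual_basis n e b \<longleftrightarrow>
     (\<forall>i\<in>{1..n}. alt_form 1 (e i)) \<and>
     (\<forall>i\<in>{1..n}. \<forall>j\<in>{1..n}. e i [b j] = (if i = j then 1 else 0)) \<and>
     (\<forall>v. v = (\<Sum>i=1..n. e i [v] *\<^sub>R b i))"

text \<open>
  The map with components \<open>e 1, \<dots>, e n\<close> in an orthonormal basis is onto: a vector orthogonal to its
  range would be a linear relation between the \<open>e i\<close>.
\<close>

lemma dual_basis_exists:
  fixes e :: "nat \<Rightarrow> 'e::euclidean_space list \<Rightarrow> real"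
  assumes "coframe n e"
  shows "\<exists>b. dual_basis n e b"
proof -
  from assms have dim: "DIM('e) = n" and alt: "\<And>i. i \<in> {1..n} \<Longrightarrow> alt_form 1 (e i)"
    and ind: "\<And>a. (\<forall>v. (\<Sum>i=1..n. a i * e i [v]) = 0) \<Longrightarrow> \<forall>i\<in>{1..n}. a i = 0"
    by (auto simp: coframe_def)
  have lin: "linear (\<lambda>v. e i [v])" if "i \<in> {1..n}" for i
    using alt_form_linear_Cons[OF alt[OF that], of "[]"] .
  obtain B where B: "bij_betw B {1..n} (Basis :: 'e set)"
    using ex_bij_betw_nat_finite_1[of "Basis :: 'e set"] dim by auto
  have ip: "B i \<bullet> B j = (if i = j then 1 else 0)" if "i \<in> {1..n}" "j \<in> {1..n}" for i j
    using B that by (metis bij_betw_apply bij_betw_imp_inj_on inj_on_eq_iff inner_Basis)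
  define T where "T v = (\<Sum>i=1..n. e i [v] *\<^sub>R B i)" for v
  have linT: "linear T" unfolding T_def
    by (intro linear_compose_sum ballI bounded_linear.linear[OF bounded_linear_scaleR_const]
        linear_conv_bounded_linear[THEN iffD1] lin)
  have T_B: "T v \<bullet> B j = e j [v]" if "j \<in> {1..n}" for v j
  proof -
    have "T v \<bullet> B j = (\<Sum>i=1..n. e i [v] * (if i = j then 1 else 0))"
      unfolding T_def inner_sum_left inner_scaleR_left using ip[OF _ that] by (intro sum.cong) auto
    also have "\<dots> = e j [v]" using that by (simp add: if_distrib cong: if_cong)
    finally show ?thesis .
  qed
  have surj: "surj T"
  proof (rule ccontr)
    assume "\<not> surj T"
    hence "span (range T) \<noteq> UNIV"
      using linear_subspace_image[OF linT subspace_UNIV] by (simp add: span_eq_iff[THEN iffD2])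
    from span_not_UNIV_orthogonal[OF this]
    obtain a where a: "a \<noteq> 0" "\<And>x. x \<in> range T \<Longrightarrow> a \<bullet> x = 0"
      using span_superset[of "range T"] by blast
    have "(\<Sum>i=1..n. (a \<bullet> B i) * e i [v]) = a \<bullet> T v" for v
      by (simp add: T_def inner_sum_right mult.commute)
    hence "\<forall>i\<in>{1..n}. a \<bullet> B i = 0" by (intro ind) (simp add: a)
    moreover have "\<exists>i\<in>{1..n}. x = B i" if "x \<in> Basis" for x
      using B that unfolding bij_betw_def by blast
    ultimately have "\<forall>x\<in>Basis. a \<bullet> x = 0" by blast
    thus False using a(1) euclidean_all_zero_iff by blast
  qed
  have inj: "inj T" using linT surj linear_surjective_imp_injective by blast
  define b where "b j = inv T (B j)" for j
  have Tb: "T (b j) = B j" for j by (simp add: b_def surj surj_f_inv_f)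
  have eb: "e i [b j] = (if i = j then 1 else 0)" if "i \<in> {1..n}" "j \<in> {1..n}" for i j
    using T_B[of i "b j"] ip[of j i] that Tb by auto
  have "v = (\<Sum>i=1..n. e i [v] *\<^sub>R b i)" for v
  proof -
    have "T (\<Sum>i=1..n. e i [v] *\<^sub>R b i) = T v"
      unfolding T_def[of v] by (simp add: linear_sum[OF linT] linear_scale[OF linT] Tb)
    from injD[OF inj this] show ?thesis by (rule sym)
  qed
  hence "dual_basis n e b" unfolding dual_basis_def using alt eb by blast
  thus ?thesis by (intro exI)
qed

lemma dual_basis_expand_linear:
  assumes "dual_basis n e b" "linear (f :: 'e::euclidean_space \<Rightarrow> real)"
  shows "f v = (\<Sum>i=1..n. e i [v] * f (b i))"
proof -
  have "v = (\<Sum>i=1..n. e i [v] *\<^sub>R b i)" using assms(1) unfolding dual_basis_def by blast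
  hence "f v = f (\<Sum>i=1..n. e i [v] *\<^sub>R b i)" by simp
  also have "\<dots> = (\<Sum>i=1..n. e i [v] * f (b i))"
    by (simp add: linear_sum[OF assms(2)] linear_scale[OF assms(2)])
  finally show ?thesis .
qed

lemma alt_form_zero_on_basis:
  assumes db: "dual_basis n e b" and "alt_form k \<omega>"
    and "\<And>js. set js \<subseteq> {1..n} \<Longrightarrow> length js = k \<Longrightarrow> \<omega> (map b js) = 0"
  shows "\<omega> vs = 0"
  using assms(2,3)
proof (induction k arbitrary: \<omega> vs)
  case 0
  thus ?case using 0(2)[of "[]"] by (cases vs) (auto simp: alt_form_eq_0)
next
  case (Suc k)
  show ?case
  proof (cases vs)
    case Nil
    thus ?thesis using Suc.prems(1) by (simp add: alt_form_eq_0)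
  next
    case (Cons v ws)
    have "\<omega> (b i # ws) = 0" if "i \<in> {1..n}" for i
    proof (rule Suc.IH[of "\<lambda>xs. \<omega> (b i # xs)"])
      show "alt_form k (\<lambda>xs. \<omega> (b i # xs))" using Suc.prems(1) by (rule alt_form_Cons)
      fix js assume "set js \<subseteq> {1..n}" "length js = k"
      thus "\<omega> (b i # map b js) = 0" using Suc.prems(2)[of "i # js"] that by simp
    qed
    thus ?thesis unfolding Cons
      by (subst dual_basis_expand_linear[OF db alt_form_linear_Cons[OF Suc.prems(1)]]) simp
  qed
qed

text \<open>
  A form of top degree is determined by its value on one basis: on basis vectors with a repetition it
  vanishes, and any others are a permutation of the basis.
\<close>

lemma alt_form_top_zero:
  assumes db: "dual_basis n e b" and alt: "alt_form n \<omega>" and z: "\<omega> (map b [1..<Suc n]) = 0"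
  shows "\<omega> vs = 0"
proof (rule alt_form_zero_on_basis[OF db alt])
  fix js assume js: "set js \<subseteq> {1..n}" "length js = n"
  show "\<omega> (map b js) = 0"
  proof (cases "distinct js")
    case False
    hence "\<not> distinct (map b js)" by (simp add: distinct_map)
    thus ?thesis by (rule alt_form_not_distinct[OF alt])
  next
    case True
    hence "set js = {1..n}"
      using js by (intro card_subset_eq) (auto simp: distinct_card)
    hence "mset js = mset [1..<Suc n]"
      using True set_eq_iff_mset_eq_distinct[of js "[1..<Suc n]"]
      by (simp add: atLeastLessThanSuc_atLeastAtMost del: upt_Suc)
    hence "mset (map b js) = mset (map b [1..<Suc n])" unfolding mset_map by (rule arg_cong)
    from alt_form_abs_mset[OF alt this] z show ?thesis by simp
  qed
qed

section \<open>Wedge products of coframes\<close>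

lemma ewedge_Nil: "ewedge e [] = (\<lambda>vs. if vs = [] then 1 else 0)"
  by (simp add: ewedge_def)

lemma ewedge_Cons: "ewedge e (i # is) = wedge (e i) (ewedge e is)"
  by (simp add: ewedge_def)

lemma alt_form_ewedge:
  "(\<And>i. i \<in> set is \<Longrightarrow> alt_form 1 (e i)) \<Longrightarrow> length is = k \<Longrightarrow> alt_form k (ewedge e is)"
proof (induction "is" arbitrary: k)
  case Nil
  thus ?case by (simp add: ewedge_Nil alt_form_0_iff of_degree_def)
next
  case (Cons i "is")
  hence "alt_form (1 + length is) (wedge (e i) (ewedge e is))"
    by (intro alt_form_wedge) auto
  thus ?case using Cons.prems(2) by (simp add: ewedge_Cons)
qed

text \<open>
  Contraction with a basis vector removes the corresponding factor, at the cost of the sign for moving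
  it to the front. This evaluates forms on basis vectors without expanding determinants.
\<close>

lemma ewedge_dual_basis:
  assumes db: "dual_basis n e b" and "set is \<subseteq> {1..n}" "distinct is" "j \<in> {1..n}"
  shows "ewedge e is (b j # vs) =
    (if j \<in> set is then (-1) ^ length (takeWhile (\<lambda>i. i \<noteq> j) is) * ewedge e (remove1 j is) vs else 0)"
  using assms(2,3)
proof (induction "is" arbitrary: vs)
  case Nil
  show ?case by (simp add: ewedge_Nil)
next
  case (Cons i "is")
  have deg: "of_degree 1 (e i)" and ei: "e i [b j] = (if i = j then 1 else 0)"
    using db Cons.prems assms(4) by (auto simp: dual_basis_def alt_form_of_degree)
  have IH: "ewedge e is (b j # xs) = 
    (if j \<in> set is then (-1) ^ length (takeWhile (\<lambda>i. i \<noteq> j) is) * ewedge e (remove1 j is) xs else 0)" for xs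
    using Cons by simp
  show ?case
    unfolding ewedge_Cons wedge_1_Cons[OF deg] IH ei
    using Cons.prems by (auto simp: ewedge_Cons wedge_scale_right)
qed

section \<open>Contractions of a $G_2$ form\<close>

lemma of_degree_1_Nil: "of_degree 1 \<alpha> \<Longrightarrow> \<alpha> [] = 0"
  by (simp add: of_degree_def)

lemma ewedge_1:
  assumes "of_degree 1 (e i)"
  shows "ewedge e [i] [u] = e i [u]"
  using assms by (simp add: ewedge_Cons ewedge_Nil wedge_1_Cons of_degree_1_Nil)

lemma ewedge_2:
  assumes "of_degree 1 (e i)" "of_degree 1 (e j)"
  shows "ewedge e [i, j] [u, v] = e i [u] * ewedge e [j] [v] - e j [u] * ewedge e [i] [v]"
  using assms by (simp add: ewedge_Cons ewedge_Nil wedge_1_Cons of_degree_1_Nil wedge_scale_right)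

lemma ewedge_3:
  assumes "of_degree 1 (e i)" "of_degree 1 (e j)" "of_degree 1 (e k)"
  shows "ewedge e [i, j, k] [u, v, w] =
    e i [u] * ewedge e [j, k] [v, w] - e j [u] * ewedge e [i, k] [v, w] + e k [u] * ewedge e [i, j] [v, w]"
  using assms by (simp add: ewedge_Cons ewedge_Nil wedge_1_Cons of_degree_1_Nil wedge_scale_right algebra_simps)

lemma ewedge_4:
  assumes "of_degree 1 (e i)" "of_degree 1 (e j)" "of_degree 1 (e k)" "of_degree 1 (e l)"
  shows "ewedge e [i, j, k, l] [u, v, w, z] =
    e i [u] * ewedge e [j, k, l] [v, w, z] - e j [u] * ewedge e [i, k, l] [v, w, z]
    + e k [u] * ewedge e [i, j, l] [v, w, z] - e l [u] * ewedge e [i, j, k] [v, w, z]"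
  using assms by (simp add: ewedge_Cons ewedge_Nil wedge_1_Cons of_degree_1_Nil wedge_scale_right algebra_simps)

text \<open>
  The Hodge dual of the model 3-form in the coframe \<open>e\<close>, that is
  $\frac12 F \wedge F + \mathrm{Im}\,\Omega \wedge e^7$ for $F = e^{12} + e^{34} + e^{56}$ and
  $\Omega = (e^1 + ie^2) \wedge (e^3 + ie^4) \wedge (e^5 + ie^6)$.
\<close>

definition g2_dual :: "(nat \<Rightarrow> 'e::euclidean_space list \<Rightarrow> real) \<Rightarrow> 'e list \<Rightarrow> real" where
  "g2_dual e vs = ewedge e [1,2,3,4] vs + ewedge e [1,2,5,6] vs + ewedge e [3,4,5,6] vs
     + ewedge e [1,3,6,7] vs + ewedge e [1,4,5,7] vs + ewedge e [2,3,5,7] vs - ewedge e [2,4,6,7] vs"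

definition coframe_metric :: "nat \<Rightarrow> (nat \<Rightarrow> 'e list \<Rightarrow> real) \<Rightarrow> 'e \<Rightarrow> 'e \<Rightarrow> real" where
  "coframe_metric n e u v = (\<Sum>i=1..n. e i [u] * e i [v])"

lemma sum_1_7: "(\<Sum>i=1..7. f i) = f 1 + f 2 + f 3 + f 4 + f 5 + f 6 + f (7::nat)" for f :: "nat \<Rightarrow> real"
  by (simp add: eval_nat_numeral)

lemmas ewedge_expand = ewedge_1 ewedge_2 ewedge_3 ewedge_4

lemma g2_deg:
  assumes "g2_coframe e \<phi>" 
  shows "of_degree 1 (e 1)" "of_degree 1 (e 2)" "of_degree 1 (e 3)" "of_degree 1 (e 4)"
     "of_degree 1 (e 5)" "of_degree 1 (e 6)" "of_degree 1 (e 7)"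
  using assms unfolding g2_coframe_def coframe_def by (auto intro!: alt_form_of_degree)

text \<open>
  The left hand side is $g(u \times v, w \times z)$ for the cross product
  $g(u \times v, w) = \phi(u,v,w)$. Written in coordinates, this is a polynomial identity. It recovers the
  dual 4-form from $\phi$ and the metric, and for $w = u$, $z = v$ it is the norm of the cross product.
\<close>

lemma g2_contraction_identity:
  fixes u v w z :: "'e::euclidean_space"
  assumes g2: "g2_coframe e \<phi>" and db: "dual_basis 7 e b"
  shows "(\<Sum>k=1..7. \<phi> [u, v, b k] * \<phi> [w, z, b k]) =
    coframe_metric 7 e u w * coframe_metric 7 e v z - coframe_metric 7 e u z * coframe_metric 7 e v w
    + g2_dual e [u, v, w, z]"
proof -
  have eb: "\<And>i j. i \<in> {1..7} \<Longrightarrow> j \<in> {1..7} \<Longrightarrow> e i [b j] = (if i = j then 1 else 0)"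
    using db by (simp add: dual_basis_def)
  note deg = g2_deg[OF g2]
  define x where "x i = e i [u]" for i
  define y where "y i = e i [v]" for i
  define p where "p i = e i [w]" for i
  define q where "q i = e i [z]" for i
  have \<phi>: "\<phi> = (\<lambda>vs. ewedge e [1,2,7] vs + ewedge e [3,4,7] vs + ewedge e [5,6,7] vs
              + ewedge e [1,3,5] vs - ewedge e [1,4,6] vs - ewedge e [2,3,6] vs - ewedge e [2,4,5] vs)"
    using g2 by (simp add: g2_coframe_def)
  show ?thesis
    unfolding \<phi> coframe_metric_def sum_1_7 g2_dual_def
    apply (simp add: ewedge_expand deg[simplified] eb flip: x_def y_def p_def q_def)
    by algebra
qed


lemma g2_coframe_alt1:
  assumes "g2_coframe e \<phi>" "i \<in> {1..7}"
  shows "alt_form 1 (e i)"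
  using assms unfolding g2_coframe_def coframe_def by blast

lemma g2_form_alt: "g2_coframe e \<phi> \<Longrightarrow> alt_form 3 \<phi>"
proof -
  assume g2: "g2_coframe e \<phi>"
  have "alt_form 3 (ewedge e [i, j, k])" if "i \<in> {1..7}" "j \<in> {1..7}" "k \<in> {1..7}" for i j k
    using alt_form_ewedge[of "[i, j, k]" e 3] g2_coframe_alt1[OF g2] that by auto
  thus ?thesis using g2 unfolding g2_coframe_def
    by (simp add: alt_form_add alt_form_diff)
qed

lemma g2_dual_alt: "g2_coframe e \<phi> \<Longrightarrow> alt_form 4 (g2_dual e)"
proof -
  assume g2: "g2_coframe e \<phi>"
  have "alt_form 4 (ewedge e [i, j, k, l])"
    if "i \<in> {1..7}" "j \<in> {1..7}" "k \<in> {1..7}" "l \<in> {1..7}" for i j k l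
    using alt_form_ewedge[of "[i, j, k, l]" e 4] g2_coframe_alt1[OF g2] that by auto
  thus ?thesis unfolding g2_dual_def[abs_def] by (simp add: alt_form_add alt_form_diff)
qed

lemma g2_form_dual_basis:
  assumes g2: "g2_coframe e \<phi>" and db: "dual_basis 7 e b"
  shows "\<phi> (b 1 # vs) = ewedge e [2,7] vs + ewedge e [3,5] vs - ewedge e [4,6] vs"
    "\<phi> (b 2 # vs) = - ewedge e [1,7] vs - ewedge e [3,6] vs - ewedge e [4,5] vs"
    "\<phi> (b 3 # vs) = ewedge e [4,7] vs - ewedge e [1,5] vs + ewedge e [2,6] vs"
    "\<phi> (b 4 # vs) = - ewedge e [3,7] vs + ewedge e [1,6] vs + ewedge e [2,5] vs"
    "\<phi> (b 5 # vs) = ewedge e [6,7] vs + ewedge e [1,3] vs - ewedge e [2,4] vs"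
    "\<phi> (b 6 # vs) = - ewedge e [5,7] vs - ewedge e [1,4] vs - ewedge e [2,3] vs"
    "\<phi> (b 7 # vs) = ewedge e [1,2] vs + ewedge e [3,4] vs + ewedge e [5,6] vs"
  using g2 unfolding g2_coframe_def by (simp_all add: ewedge_dual_basis[OF db])

text \<open>
  This is $\iota_u\phi \wedge \iota_u\phi \wedge \phi = 6\,g(u,u)\,\mathrm{vol}$, evaluated on the basis that
  \<open>vol\<close> maps to 1. Its left hand side does not refer to the coframe, so it ties the metric to the volume
  form.
\<close>

lemma g2_volume_identity:
  fixes u :: "'e::euclidean_space"
  assumes g2: "g2_coframe e \<phi>" and db: "dual_basis 7 e b"
  defines "\<omega> \<equiv> (\<lambda>xs. \<phi> (u # xs))"
  shows "wedge \<omega> (wedge \<omega> \<phi>) (map b [1..<8]) = 6 * coframe_metric 7 e u u"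
proof -
  have eb: "\<And>i j. i \<in> {1..7} \<Longrightarrow> j \<in> {1..7} \<Longrightarrow> e i [b j] = (if i = j then 1 else 0)"
    using db by (simp add: dual_basis_def)
  note deg = g2_deg[OF g2]
  have ups: "[1..<8] = [1,2,3,4,5,6,7::nat]" by (simp add: upt_rec)
  have d3: "of_degree 3 \<phi>" using g2_form_alt[OF g2] by (rule alt_form_of_degree)
  hence d2: "of_degree 2 \<omega>" by (simp add: \<omega>_def of_degree_def)
  have d1: "of_degree 1 (\<lambda>xs. \<omega> (v # xs))" for v using d3 by (simp add: \<omega>_def of_degree_def)
  have z: "\<omega> [] = 0" "\<phi> [] = 0" "\<omega> [v] = 0" "\<omega> (v # w # v1 # xs) = 0" "\<phi> [v] = 0" "\<phi> [v,w] = 0" "\<phi> (v # w # v1 # v2 # xs) = 0" for v w v1 v2 xs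
    using d2 d3 by (auto simp: of_degree_def)
  \<comment> \<open>Basis vectors are moved to the front, where \<open>g2_form_dual_basis\<close> applies.\<close>
  have \<omega>: "\<omega> [v, w] = \<phi> [v, w, u]" for v w
    using alt_form_swap[OF g2_form_alt[OF g2], of "[]" u "[]" v "[w]"]
      alt_form_swap[OF g2_form_alt[OF g2], of "[v]" u "[]" w "[]"] by (simp add: \<omega>_def)
  show ?thesis
    unfolding ups coframe_metric_def sum_1_7
    apply (simp add: wedge_2_Cons[OF d2] wedge_1_Cons[OF d1] z)
    by (simp add: \<omega> g2_form_dual_basis[OF g2 db, simplified] ewedge_1 ewedge_2 deg[simplified] eb power2_eq_square)
qed

lemma dual_basis_linear:
  "dual_basis n e b \<Longrightarrow> i \<in> {1..n} \<Longrightarrow> linear (\<lambda>v. e i [v])"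
  unfolding dual_basis_def using alt_form_linear_Cons[of 1 "e i" "[]"] by simp

lemma coframe_metric_commute: "coframe_metric n e u v = coframe_metric n e v u"
  by (simp add: coframe_metric_def mult.commute)

lemma linear_coframe_metric:
  assumes "dual_basis n e b"
  shows "linear (\<lambda>v. coframe_metric n e u v)"
  unfolding coframe_metric_def
  using linear_compose_scale_right[OF dual_basis_linear[OF assms]]
  by (intro linear_compose_sum ballI) auto

lemma coframe_metric_dual_basis:
  assumes "dual_basis n e b" "j \<in> {1..n}"
  shows "coframe_metric n e v (b j) = e j [v]"
proof -
  have "coframe_metric n e v (b j) = (\<Sum>i=1..n. e i [v] * (if i = j then 1 else 0))"
    unfolding coframe_metric_def using assms by (intro sum.cong) (auto simp: dual_basis_def)
  also have "\<dots> = e j [v]" using assms(2) by (simp add: if_distrib cong: if_cong)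
  finally show ?thesis .
qed

text \<open>
  Contraction of two slots with the metric may be computed in any two orthonormal bases: expand one slot
  in the first basis, and collect the terms in the second.
\<close>

lemma metric_trace_unique:
  fixes B :: "'e::euclidean_space \<Rightarrow> 'e \<Rightarrow> real"
  assumes db: "dual_basis n e b" and db': "dual_basis n e' b'"
    and same: "\<And>u v. coframe_metric n e u v = coframe_metric n e' u v"
    and lin1: "\<And>v. linear (\<lambda>u. B u v)" and lin2: "\<And>u. linear (B u)"
  shows "(\<Sum>i=1..n. B (b i) (b i)) = (\<Sum>i=1..n. B (b' i) (b' i))"
proof -
  have eq: "e j [b' i] = e' i [b j]" if "i \<in> {1..n}" "j \<in> {1..n}" for i j
    using coframe_metric_dual_basis[OF db that(2), of "b' i"] coframe_metric_dual_basis[OF db' that(1), of "b j"]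
      same coframe_metric_commute by metis
  have "(\<Sum>i=1..n. B (b' i) (b' i)) = (\<Sum>i=1..n. \<Sum>j=1..n. e j [b' i] * B (b j) (b' i))"
    by (subst dual_basis_expand_linear[OF db lin1]) simp
  also have "\<dots> = (\<Sum>i=1..n. \<Sum>j=1..n. e' i [b j] * B (b j) (b' i))"
    by (intro sum.cong) (simp_all add: eq)
  also have "\<dots> = (\<Sum>j=1..n. \<Sum>i=1..n. e' i [b j] * B (b j) (b' i))"
    by (rule sum.swap)
  also have "\<dots> = (\<Sum>j=1..n. B (b j) (b j))"
    by (intro sum.cong refl dual_basis_expand_linear[OF db' lin2, symmetric])
  finally show ?thesis by simp
qed

text \<open>
  An orthonormal system of maximal size is dual to the coframe $g(c_i, \cdot)$, and that coframe has the
  same metric. So an arbitrary orthonormal basis can take the place of an adapted one.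
\<close>

lemma orthonormal_dual_basis:
  fixes e :: "nat \<Rightarrow> 'e::euclidean_space list \<Rightarrow> real"
  assumes db: "dual_basis n e b" and dim: "DIM('e) = n"
    and orth: "\<And>i j. i \<in> {1..n} \<Longrightarrow> j \<in> {1..n} \<Longrightarrow> coframe_metric n e (c i) (c j) = (if i = j then 1 else 0)"
  shows "\<exists>e'. dual_basis n e' c \<and> (\<forall>u v. coframe_metric n e' u v = coframe_metric n e u v)"
proof -
  define e' where "e' i vs = (case vs of [v] \<Rightarrow> coframe_metric n e (c i) v | _ \<Rightarrow> 0)" for i vs
  have e': "e' i [v] = coframe_metric n e (c i) v" for i v by (simp add: e'_def)
  have alt: "alt_form 1 (e' i)" for i
    unfolding alt_form_def
  proof (intro conjI allI impI)
    fix vs :: "'e list" assume "length vs \<noteq> 1"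
    thus "e' i vs = 0" by (auto simp: e'_def split: list.splits)
  next
    fix vs :: "'e list" and k :: nat assume "length vs = 1 \<and> k < 1"
    then obtain w where "vs = [w]" "k = 0" by (auto simp: length_Suc_conv)
    thus "linear (\<lambda>v. e' i (vs[k := v]))" by (simp add: e' linear_coframe_metric[OF db])
  next
    fix vs :: "'e list" assume "length vs = 1 \<and> \<not> distinct vs"
    thus "e' i vs = 0" by (auto simp: length_Suc_conv)
  qed
  have orth': "e' i [c j] = (if i = j then 1 else 0)" if "i \<in> {1..n}" "j \<in> {1..n}" for i j
    using orth[OF that] by (simp add: e')
  have "coframe n e'"
    unfolding coframe_def
  proof (intro conjI allI impI ballI)
    fix a j assume z: "\<forall>v. (\<Sum>i=1..n. a i * e' i [v]) = 0" and j: "j \<in> {1..n}"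
    have "0 = (\<Sum>i=1..n. a i * e' i [c j])" using z by simp
    also have "\<dots> = (\<Sum>i=1..n. a i * (if i = j then 1 else 0))"
      using orth'[OF _ j] by (intro sum.cong) auto
    also have "\<dots> = a j" using j by (simp add: if_distrib cong: if_cong)
    finally show "a j = 0" by simp
  qed (use dim alt in auto)
  then obtain b' where db': "dual_basis n e' b'" using dual_basis_exists by blast
  have cb: "c j = b' j" if j: "j \<in> {1..n}" for j
  proof -
    have "c j = (\<Sum>i=1..n. e' i [c j] *\<^sub>R b' i)" using db' unfolding dual_basis_def by blast
    also have "\<dots> = (\<Sum>i=1..n. (if i = j then 1 else 0) *\<^sub>R b' i)"
      using orth'[OF _ j] by (intro sum.cong) auto
    also have "\<dots> = (\<Sum>i=1..n. if i = j then b' i else 0)" by (intro sum.cong) auto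
    also have "\<dots> = b' j" using j by simp
    finally show ?thesis .
  qed
  have exp: "v = (\<Sum>i=1..n. e' i [v] *\<^sub>R c i)" for v
  proof -
    have "v = (\<Sum>i=1..n. e' i [v] *\<^sub>R b' i)" using db' unfolding dual_basis_def by blast
    also have "\<dots> = (\<Sum>i=1..n. e' i [v] *\<^sub>R c i)" by (intro sum.cong) (auto simp: cb)
    finally show ?thesis .
  qed
  hence dbc: "dual_basis n e' c" unfolding dual_basis_def using alt orth' by blast
  have "coframe_metric n e' u v = coframe_metric n e u v" for u v
  proof -
    have "coframe_metric n e u v = (\<Sum>i=1..n. e' i [v] * coframe_metric n e u (c i))"
      by (rule dual_basis_expand_linear[OF dbc linear_coframe_metric[OF db]])
    also have "\<dots> = coframe_metric n e' u v"
      by (simp add: coframe_metric_def[of n e'] e' coframe_metric_commute[of n e u] mult.commute)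
    finally show ?thesis by simp
  qed
  with dbc show ?thesis by blast
qed

section \<open>The metric of a $G_2$ form\<close>

text \<open>
  The factor is the value of one volume form on the basis dual to the other coframe: both sides of
  \<open>g2_volume_identity\<close> are 7-forms, so the identity may be evaluated on that basis.
\<close>

lemma g2_metric_proportional:
  fixes e e' :: "nat \<Rightarrow> 'e::euclidean_space list \<Rightarrow> real"
  assumes g2: "g2_coframe e \<phi>" and db: "dual_basis 7 e b"
    and g2': "g2_coframe e' \<phi>" and db': "dual_basis 7 e' b'"
  obtains c where "\<And>u v. coframe_metric 7 e' u v = c * coframe_metric 7 e u v"
proof
  define vol where "vol = ewedge e [1,2,3,4,5,6,7]"
  define c where "c = vol (map b' [1..<8])"
  have ups: "[1..<8] = [1,2,3,4,5,6,7::nat]" by (simp add: upt_rec)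
  have diag: "coframe_metric 7 e' u u = c * coframe_metric 7 e u u" for u
  proof -
    define \<omega> where "\<omega> = (\<lambda>xs. \<phi> (u # xs))"
    have "alt_form 2 \<omega>"
      using alt_form_Cons[of 2 \<phi>] g2_form_alt[OF g2] by (simp add: \<omega>_def)
    hence "alt_form (2 + (2 + 3)) (wedge \<omega> (wedge \<omega> \<phi>))"
      by (intro alt_form_wedge g2_form_alt[OF g2])
    moreover have "alt_form 7 vol"
      unfolding vol_def by (rule alt_form_ewedge) (auto intro!: g2_coframe_alt1[OF g2, simplified])
    ultimately have alt: "alt_form 7 (\<lambda>vs. wedge \<omega> (wedge \<omega> \<phi>) vs - 6 * coframe_metric 7 e u u * vol vs)"
      by (intro alt_form_diff alt_form_scale) simp_all
    have "vol (map b [1..<8]) = 1"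
      unfolding ups vol_def by (simp add: ewedge_dual_basis[OF db] ewedge_Nil)
    hence "wedge \<omega> (wedge \<omega> \<phi>) vs - 6 * coframe_metric 7 e u u * vol vs = 0" for vs
      using alt_form_top_zero[OF db alt, of vs] g2_volume_identity[OF g2 db, of u]
      by (simp add: \<omega>_def del: upt_Suc)
    from this[of "map b' [1..<8]"] show ?thesis
      using g2_volume_identity[OF g2' db', of u] by (simp add: \<omega>_def c_def mult.commute)
  qed
  fix u v :: 'e
  have pol: "coframe_metric 7 f (u + v) (u + v) =
      coframe_metric 7 f u u + 2 * coframe_metric 7 f u v + coframe_metric 7 f v v"
    if "dual_basis 7 f d" for f d
    using linear_add[OF linear_coframe_metric[OF that]] coframe_metric_commute[of 7 f] by (smt (verit))
  show "coframe_metric 7 e' u v = c * coframe_metric 7 e u v"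
    using pol[OF db] pol[OF db'] diag[of u] diag[of v] diag[of "u + v"] by (simp add: algebra_simps)
qed

text \<open>
  Let $g' = c\,g$, and let $X$ and $X'$ be the cross products of $b_1$ and $b_2$ for the two metrics. They
  represent the same functional $\phi(b_1,b_2,\cdot)$, so $g(X,w) = g'(X',w)$ for all \<open>w\<close>. Then
  $1 = g(X,X) = g'(X',X) = c\,g(X,X') = c\,g'(X',X')$, while $g'(X',X')$ is $c^2$ by the norm formula for
  $g'$. Thus $c^3 = 1$.
\<close>

lemma g2_metric_unique:
  fixes e e' :: "nat \<Rightarrow> 'e::euclidean_space list \<Rightarrow> real"
  assumes g2: "g2_coframe e \<phi>" and db: "dual_basis 7 e b"
    and g2': "g2_coframe e' \<phi>" and db': "dual_basis 7 e' b'"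
  shows "coframe_metric 7 e' u v = coframe_metric 7 e u v"
proof -
  obtain c where c: "\<And>u v. coframe_metric 7 e' u v = c * coframe_metric 7 e u v"
    using g2_metric_proportional[OF assms] by metis
  define cross where "cross d = (\<Sum>k=1..7. \<phi> [b 1, b 2, d k] *\<^sub>R d k)" for d :: "nat \<Rightarrow> 'e"
  have cross: "coframe_metric 7 f (cross d) w = \<phi> [b 1, b 2, w]"
    and norm: "coframe_metric 7 f (cross d) (cross d) =
      coframe_metric 7 f (b 1) (b 1) * coframe_metric 7 f (b 2) (b 2) - (coframe_metric 7 f (b 1) (b 2))\<^sup>2"
    if f: "g2_coframe f \<phi>" and d: "dual_basis 7 f d" for f d w
  proof -
    note lin = linear_coframe_metric[OF d] 
    have l3: "linear (\<lambda>w. \<phi> [b 1, b 2, w])"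
      using alt_form_linear[OF g2_form_alt[OF g2], of "[b 1, b 2]" "[]"] by simp
    show m: "coframe_metric 7 f (cross d) w = \<phi> [b 1, b 2, w]" for w
    proof -
      have "coframe_metric 7 f (cross d) w = (\<Sum>k=1..7. \<phi> [b 1, b 2, d k] * coframe_metric 7 f w (d k))"
        unfolding cross_def
        by (subst coframe_metric_commute) (simp add: linear_sum[OF lin] linear_scale[OF lin])
      also have "\<dots> = (\<Sum>k=1..7. f k [w] * \<phi> [b 1, b 2, d k])"
        by (intro sum.cong) (simp_all add: coframe_metric_dual_basis[OF d])
      also have "\<dots> = \<phi> [b 1, b 2, w]" by (rule dual_basis_expand_linear[OF d l3, symmetric])
      finally show ?thesis .
    qed
    have "coframe_metric 7 f (cross d) (cross d) = \<phi> [b 1, b 2, cross d]" by (rule m)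
    also have "\<dots> = (\<Sum>k=1..7. \<phi> [b 1, b 2, d k] * \<phi> [b 1, b 2, d k])"
      unfolding cross_def[of d] by (simp add: linear_sum[OF l3] linear_scale[OF l3] del: One_nat_def)
    also have "\<dots> = coframe_metric 7 f (b 1) (b 1) * coframe_metric 7 f (b 2) (b 2)
        - coframe_metric 7 f (b 1) (b 2) * coframe_metric 7 f (b 2) (b 1)"
      unfolding g2_contraction_identity[OF f d]
      using alt_form_not_distinct[OF g2_dual_alt[OF f], of "[b 1, b 2, b 1, b 2]"] by simp
    finally show "coframe_metric 7 f (cross d) (cross d) =
      coframe_metric 7 f (b 1) (b 1) * coframe_metric 7 f (b 2) (b 2) - (coframe_metric 7 f (b 1) (b 2))\<^sup>2"
      using coframe_metric_commute[of 7 f "b 2" "b 1"] by (simp add: power2_eq_square)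
  qed
  have on: "coframe_metric 7 e (b 1) (b 1) = 1" "coframe_metric 7 e (b 2) (b 2) = 1" "coframe_metric 7 e (b 1) (b 2) = 0"
    using db by (simp_all add: coframe_metric_dual_basis[OF db] dual_basis_def)
  have "1 = coframe_metric 7 e (cross b) (cross b)" using norm[OF g2 db] on by simp
  also have "\<dots> = coframe_metric 7 e' (cross b') (cross b)" using cross[OF g2 db] cross[OF g2' db'] by simp
  also have "\<dots> = c * coframe_metric 7 e (cross b) (cross b')" by (simp add: c coframe_metric_commute)
  also have "coframe_metric 7 e (cross b) (cross b') = coframe_metric 7 e' (cross b') (cross b')"
    using cross[OF g2 db] cross[OF g2' db'] by simp
  also have "\<dots> = c\<^sup>2" using norm[OF g2' db'] on by (simp add: c power2_eq_square)
  finally have "c ^ 3 = 1" by (simp add: eval_nat_numeral)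
  hence "(c - 1) * (c\<^sup>2 + c + 1) = 0" by (simp add: algebra_simps eval_nat_numeral)
  moreover have "c\<^sup>2 + c + 1 = (c + 1/2)\<^sup>2 + 3/4" by (simp add: power2_eq_square algebra_simps)
  hence "c\<^sup>2 + c + 1 > 0" using zero_le_power2[of "c + 1/2"] by linarith
  ultimately have "c = 1" by simp
  thus ?thesis by (simp add: c)
qed


section \<open>The Hodge star of a $G_2$ form\<close>

lemma linear_times:
  fixes f :: "'e::real_vector \<Rightarrow> real"
  assumes "linear f"
  shows "linear (\<lambda>x. r * f x)" "linear (\<lambda>x. f x * r)"
  using linear_compose_scale_right[OF assms, of r] by (simp_all add: mult.commute)

lemma sum_lists_Suc:
  fixes f :: "nat list \<Rightarrow> real"
  assumes "finite A"
  shows "(\<Sum>is | set is \<subseteq> A \<and> length is = Suc k. f is) =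
    (\<Sum>i\<in>A. \<Sum>is | set is \<subseteq> A \<and> length is = k. f (i # is))"
proof -
  have "(\<Sum>is | set is \<subseteq> A \<and> length is = Suc k. f is) =
      (\<Sum>(is, i) \<in> {is. set is \<subseteq> A \<and> length is = k} \<times> A. f (i # is))"
    unfolding lists_length_Suc_eq
    by (subst sum.reindex) (auto simp: inj_on_def intro!: sum.cong)
  also have "\<dots> = (\<Sum>is | set is \<subseteq> A \<and> length is = k. \<Sum>i\<in>A. f (i # is))"
    by (simp add: sum.cartesian_product)
  also have "\<dots> = (\<Sum>i\<in>A. \<Sum>is | set is \<subseteq> A \<and> length is = k. f (i # is))"
    by (rule sum.swap)
  finally show ?thesis .
qed

lemma sum_lists_3:
  fixes f :: "nat list \<Rightarrow> real"
  assumes "finite A"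
  shows "(\<Sum>is | set is \<subseteq> A \<and> length is = 3. f is) = (\<Sum>i\<in>A. \<Sum>j\<in>A. \<Sum>k\<in>A. f [i, j, k])"
proof -
  have "{is. is = [] \<and> set is \<subseteq> A} = {[]}" by auto
  thus ?thesis using assms by (simp add: eval_nat_numeral sum_lists_Suc conj_commute)
qed

text \<open>
  The index formula for the star in the dual basis. The factor 6 counts the orderings of three indices
  and cancels $1/3!$.
\<close>

lemma g2_dual_contraction:
  assumes g2: "g2_coframe e \<phi>" and db: "dual_basis 7 e b"
  shows "(\<Sum>i=1..7. \<Sum>j=1..7. \<Sum>k=1..7.
      \<phi> [b i, b j, b k] * ewedge e [1,2,3,4,5,6,7] (b i # b j # b k # vs)) = 6 * g2_dual e vs"
proof -
  have eb: "\<And>i j. i \<in> {1..7} \<Longrightarrow> j \<in> {1..7} \<Longrightarrow> e i [b j] = (if i = j then 1 else 0)"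
    using db by (simp add: dual_basis_def)
  \<comment> \<open>With the volume form hidden behind \<open>V\<close>, the vanishing of most components of \<open>\<phi>\<close> reduces
    343 summands to 42 before any component of the volume form is computed.\<close>
  define V where "V i j k = ewedge e [1,2,3,4,5,6,7] (b i # b j # b k # vs)" for i j k
  have "(\<Sum>i=1..7. \<Sum>j=1..7. \<Sum>k=1..7. \<phi> [b i, b j, b k] * V i j k) = 6 * g2_dual e vs"
    unfolding sum_1_7 
    apply (simp add: g2_form_dual_basis[OF g2 db, simplified] ewedge_1 ewedge_2 g2_deg[OF g2, simplified] eb)
    by (simp add: V_def g2_dual_def ewedge_dual_basis[OF db])
  thus ?thesis by (simp only: V_def)
qed

text \<open>
  In \<open>g2_contraction_identity\<close> the metric terms agree for both coframes, and the left hand side is a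
  contraction with the metric, which does not depend on the basis.
\<close>

lemma g2_dual_unique:
  fixes e e' :: "nat \<Rightarrow> 'e::euclidean_space list \<Rightarrow> real"
  assumes g2: "g2_coframe e \<phi>" and g2': "g2_coframe e' \<phi>"
  shows "g2_dual e' = g2_dual e"
proof
  fix vs :: "'e list"
  obtain b where db: "dual_basis 7 e b" using dual_basis_exists g2 unfolding g2_coframe_def by blast
  obtain b' where db': "dual_basis 7 e' b'" using dual_basis_exists g2' unfolding g2_coframe_def by blast
  note same = g2_metric_unique[OF g2 db g2' db']
  show "g2_dual e' vs = g2_dual e vs"
  proof (cases "length vs = 4")
    case True
    then obtain u v w z where vs: "vs = [u, v, w, z]" by (auto simp: eval_nat_numeral length_Suc_conv)
    have lin: "linear (\<lambda>x. \<phi> [u', v', x])" for u' v'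
      using alt_form_linear[OF g2_form_alt[OF g2], of "[u', v']" "[]"] by simp
    have "(\<Sum>k=1..7. \<phi> [u, v, b' k] * \<phi> [w, z, b' k]) = (\<Sum>k=1..7. \<phi> [u, v, b k] * \<phi> [w, z, b k])"
      by (rule metric_trace_unique[OF db' db same])
        (auto intro!: linear_times lin)
    thus ?thesis unfolding vs g2_contraction_identity[OF g2 db] g2_contraction_identity[OF g2' db'] same by simp
  next
    case False
    thus ?thesis using alt_form_eq_0[OF g2_dual_alt] g2 g2' by metis
  qed
qed

text \<open>
  The star is computed in the coframe \<open>f\<close> that defines the metric and in the orthonormal basis \<open>c\<close>, both
  arbitrary choices. Since the index formula is a threefold contraction with the metric, \<open>c\<close> may be
  replaced by the basis dual to \<open>f\<close>; and the result is the dual form for \<open>f\<close>, which is that for \<open>e\<close>.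
\<close>

theorem g2_star_eq:
  fixes e :: "nat \<Rightarrow> 'e::euclidean_space list \<Rightarrow> real"
  assumes g2: "g2_coframe e \<phi>"
  shows "g2_star \<phi> = g2_dual e"
proof
  fix vs :: "'e list"
  define f where "f = g2_frame \<phi>"
  have f: "g2_coframe f \<phi>" unfolding f_def g2_frame_def by (rule someI[of "\<lambda>e. g2_coframe e \<phi>", OF g2])
  have dim: "DIM('e) = 7" using f by (simp add: g2_coframe_def coframe_def)
  obtain b where db: "dual_basis 7 f b" using dual_basis_exists f unfolding g2_coframe_def by blast
  define g where "g = coframe_metric 7 f"
  have g: "g2_metric \<phi> = g"
    by (intro ext) (simp add: g2_metric_def g_def coframe_metric_def f_def)
  define vol where "vol = ewedge f [1,2,3,4,5,6,7]"
  have vol: "g2_vol \<phi> = vol" by (simp add: g2_vol_def vol_def f_def)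
  define c where "c = (SOME b. orthonormal_basis g b)"
  have "orthonormal_basis g (\<lambda>i. b (Suc i))"
    unfolding orthonormal_basis_def dim g_def
    using coframe_metric_dual_basis[OF db] db by (auto simp: dual_basis_def)
  hence c: "orthonormal_basis g c" unfolding c_def by (rule someI[of "orthonormal_basis g"])
  \<comment> \<open>Orthonormal bases are indexed from 0, coframes from 1.\<close>
  define c' where "c' i = c (i - 1)" for i
  have "coframe_metric 7 f (c' i) (c' j) = (if i = j then 1 else 0)" if "i \<in> {1..7}" "j \<in> {1..7}" for i j
  proof -
    have "i - 1 < 7" "j - 1 < 7" "i - 1 = j - 1 \<longleftrightarrow> i = j" using that by auto
    thus ?thesis using c unfolding orthonormal_basis_def dim g_def c'_def by simp
  qed
  from orthonormal_dual_basis[OF db dim this]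
  obtain h where dbc: "dual_basis 7 h c'" and h: "\<And>u v. coframe_metric 7 h u v = coframe_metric 7 f u v" by blast
  note alt\<phi> = g2_form_alt[OF f]
  have altvol: "alt_form 7 vol"
    unfolding vol_def by (rule alt_form_ewedge) (auto intro!: g2_coframe_alt1[OF f, simplified])
  have star: "g2_star \<phi> vs = (\<Sum>is | set is \<subseteq> {..<7} \<and> length is = 7 - length vs.
            \<phi> (map c is) * vol (map c is @ vs)) / fact (7 - length vs)"
    by (simp add: g2_star_def hodge_star_def g vol dim c_def[symmetric] Let_def)
  show "g2_star \<phi> vs = g2_dual e vs"
  proof (cases "length vs = 4")
    case False
    have "\<phi> (map c is) = 0" if "length is = 7 - length vs" for "is"
      using that False by (intro alt_form_eq_0[OF alt\<phi>]) auto
    hence "g2_star \<phi> vs = 0" unfolding star by simp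
    thus ?thesis using alt_form_eq_0[OF g2_dual_alt[OF g2] False] by simp
  next
    case True
    define B where "B x1 x2 x3 y1 y2 y3 = \<phi> [x1, x2, x3] * vol (y1 # y2 # y3 # vs)" for x1 x2 x3 y1 y2 y3
    have lin: "linear (\<lambda>x. \<phi> (x # xs))" "linear (\<lambda>x. \<phi> (x1 # x # xs))" "linear (\<lambda>x. \<phi> (x1 # x2 # x # xs))"
      "linear (\<lambda>x. vol (x # xs))" "linear (\<lambda>x. vol (x1 # x # xs))" "linear (\<lambda>x. vol (x1 # x2 # x # xs))"
      for x1 x2 xs
      using alt_form_linear[OF alt\<phi>, of "[]"] alt_form_linear[OF alt\<phi>, of "[x1]"] alt_form_linear[OF alt\<phi>, of "[x1, x2]"]
        alt_form_linear[OF altvol, of "[]"] alt_form_linear[OF altvol, of "[x1]"] alt_form_linear[OF altvol, of "[x1, x2]"]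
      by auto
    have tr: "(\<Sum>i=1..7. C (c' i) (c' i)) = (\<Sum>i=1..7. C (b i) (b i))"
      if "\<And>v. linear (\<lambda>u. C u v)" "\<And>u. linear (C u)" for C :: "'e \<Rightarrow> 'e \<Rightarrow> real"
      by (rule metric_trace_unique[OF dbc db h that])
    have "g2_star \<phi> vs = (\<Sum>i<7. \<Sum>j<7. \<Sum>k<7. B (c i) (c j) (c k) (c i) (c j) (c k)) / 6"
      by (simp add: star True sum_lists_3 B_def fact_numeral)
    also have "(\<Sum>i<7. \<Sum>j<7. \<Sum>k<7. B (c i) (c j) (c k) (c i) (c j) (c k)) =
        (\<Sum>i=1..7. \<Sum>j=1..7. \<Sum>k=1..7. B (c' i) (c' j) (c' k) (c' i) (c' j) (c' k))"
      by (simp add: sum.atLeast1_atMost_eq c'_def)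
    also have "\<dots> = (\<Sum>i=1..7. \<Sum>j=1..7. \<Sum>k=1..7. B (c' i) (c' j) (b k) (c' i) (c' j) (b k))"
      by (intro sum.cong refl tr) (auto simp: B_def intro!: linear_times lin)
    also have "\<dots> = (\<Sum>i=1..7. \<Sum>j=1..7. \<Sum>k=1..7. B (c' i) (b j) (b k) (c' i) (b j) (b k))"
      by (intro sum.cong refl tr[of "\<lambda>x y. \<Sum>k=1..7. B _ x (b k) _ y (b k)"])
        (auto simp: B_def intro!: linear_times lin linear_compose_sum)
    also have "\<dots> = (\<Sum>i=1..7. \<Sum>j=1..7. \<Sum>k=1..7. B (b i) (b j) (b k) (b i) (b j) (b k))"
      by (rule tr[of "\<lambda>x y. \<Sum>j=1..7. \<Sum>k=1..7. B x (b j) (b k) y (b j) (b k)"])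
        (auto simp: B_def intro!: linear_times lin linear_compose_sum)
    also have "\<dots> = 6 * g2_dual f vs"
      unfolding B_def vol_def by (rule g2_dual_contraction[OF f db])
    finally show ?thesis using g2_dual_unique[OF f g2] by simp
  qed
qed

section \<open>Functions of class $C^k$\<close>

lemma frechet_derivative_cong_open:
  assumes "open S" "x \<in> S" "\<And>y. y \<in> S \<Longrightarrow> f y = g y"
  shows "frechet_derivative f (at x) = frechet_derivative g (at x)"
proof -
  have "(f has_derivative D) (at x) \<longleftrightarrow> (g has_derivative D) (at x)" for D
    using has_derivative_transform_within_open[of f D x UNIV S g]
      has_derivative_transform_within_open[of g D x UNIV S f] assms by auto
  thus ?thesis by (simp add: frechet_derivative_def)
qed

lemma frechet_derivative_eqI: "(f has_derivative D) (at x) \<Longrightarrow> frechet_derivative f (at x) = D"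
  using frechet_derivative_at by metis

lemma differentiable_frechet: "f differentiable at x \<Longrightarrow> (f has_derivative frechet_derivative f (at x)) (at x)"
  by (simp add: frechet_derivative_works)

lemma differentiable_cong_open:
  assumes "open S" "x \<in> S" "\<And>y. y \<in> S \<Longrightarrow> f y = g y" "f differentiable at x"
  shows "g differentiable at x"
  using assms has_derivative_transform_within_open[of f _ x UNIV S g] unfolding differentiable_def by blast

lemma Ck_cong:
  assumes "open S" "\<And>x. x \<in> S \<Longrightarrow> f x = g x" "Ck n S f"
  shows "Ck n S g"
  using assms(2,3)
proof (induction n arbitrary: f g)
  case 0
  thus ?case by simp
next
  case (Suc n)
  have d: "frechet_derivative f (at x) = frechet_derivative g (at x)" if "x \<in> S" for x
    using frechet_derivative_cong_open[OF assms(1) that] Suc.prems(1) by blast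
  have "g differentiable at x" if "x \<in> S" for x
    using differentiable_cong_open[OF assms(1) that] Suc.prems that by auto
  moreover have "Ck n S (\<lambda>x. frechet_derivative g (at x) v)" for v
    by (rule Suc.IH[of "\<lambda>x. frechet_derivative f (at x) v"]) (use d Suc.prems in auto)
  ultimately show ?case by simp
qed

lemma Ck_Suc_imp_Ck: "Ck (Suc n) S f \<Longrightarrow> Ck n S f"
proof (induction n arbitrary: f)
  case 0
  thus ?case
    by (auto intro!: continuous_at_imp_continuous_on differentiable_imp_continuous_within)
qed auto

lemma Ck_local:
  assumes "\<And>x. x \<in> S \<Longrightarrow> \<exists>U. open U \<and> x \<in> U \<and> Ck n U f"
  shows "Ck n S f"
  using assms
proof (induction n arbitrary: f)
  case 0
  thus ?case
    by (auto intro!: continuous_at_imp_continuous_on simp: continuous_on_eq_continuous_at)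
       (metis continuous_on_eq_continuous_at)
next
  case (Suc n)
  show ?case unfolding Ck.simps
    using Suc.prems by (auto intro!: Suc.IH) (metis+)
qed

lemma Ck_const: "Ck n S (\<lambda>_. c)"
  by (induction n arbitrary: c) simp_all

lemma Ck_add:
  assumes "open S" "Ck n S f" "Ck n S g"
  shows "Ck n S (\<lambda>x. f x + g x)"
  using assms(2,3)
proof (induction n arbitrary: f g)
  case 0
  thus ?case by (simp add: continuous_on_add)
next
  case (Suc n)
  have "Ck n S (\<lambda>x. frechet_derivative (\<lambda>x. f x + g x) (at x) v)" for v
  proof (rule Ck_cong[OF assms(1)])
    show "Ck n S (\<lambda>x. frechet_derivative f (at x) v + frechet_derivative g (at x) v)"
      using Suc by simp
    show "frechet_derivative f (at x) v + frechet_derivative g (at x) v =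
        frechet_derivative (\<lambda>x. f x + g x) (at x) v" if "x \<in> S" for x
    proof -
      have "f differentiable at x" "g differentiable at x" using Suc.prems that by auto
      from has_derivative_add[OF this[THEN differentiable_frechet]]
      show ?thesis by (simp add: frechet_derivative_eqI)
    qed
  qed
  thus ?case using Suc.prems by simp
qed

lemma Ck_mult:
  fixes f g :: "'e::real_normed_vector \<Rightarrow> real"
  assumes "open S" "Ck n S f" "Ck n S g"
  shows "Ck n S (\<lambda>x. f x * g x)"
  using assms(2,3)
proof (induction n arbitrary: f g)
  case 0
  thus ?case by (simp add: continuous_on_mult)
next
  case (Suc n)
  have "Ck n S (\<lambda>x. frechet_derivative (\<lambda>x. f x * g x) (at x) v)" for v
  proof (rule Ck_cong[OF assms(1)])
    show "Ck n S (\<lambda>x. f x * frechet_derivative g (at x) v + frechet_derivative f (at x) v * g x)"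
      using Suc.prems Suc.IH Ck_Suc_imp_Ck[OF Suc.prems(1)] Ck_Suc_imp_Ck[OF Suc.prems(2)]
      by (intro Ck_add[OF assms(1)]) simp_all
    show "f x * frechet_derivative g (at x) v + frechet_derivative f (at x) v * g x =
        frechet_derivative (\<lambda>x. f x * g x) (at x) v" if "x \<in> S" for x
    proof -
      have "f differentiable at x" "g differentiable at x" using Suc.prems that by auto
      from has_derivative_mult[OF this[THEN differentiable_frechet]]
      show ?thesis by (simp add: frechet_derivative_eqI)
    qed
  qed
  thus ?case using Suc.prems by simp
qed

lemma smooth_on_const: "smooth_on S (\<lambda>_. c)"
  by (simp add: smooth_on_def Ck_const)

lemma smooth_on_add: "open S \<Longrightarrow> smooth_on S f \<Longrightarrow> smooth_on S g \<Longrightarrow> smooth_on S (\<lambda>x. f x + g x)"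
  by (simp add: smooth_on_def Ck_add)

lemma smooth_on_mult:
  fixes f g :: "'e::real_normed_vector \<Rightarrow> real"
  shows "open S \<Longrightarrow> smooth_on S f \<Longrightarrow> smooth_on S g \<Longrightarrow> smooth_on S (\<lambda>x. f x * g x)"
  by (simp add: smooth_on_def Ck_mult)

lemma smooth_on_minus:
  fixes f :: "'e::real_normed_vector \<Rightarrow> real"
  shows "open S \<Longrightarrow> smooth_on S f \<Longrightarrow> smooth_on S (\<lambda>x. - f x)"
  using smooth_on_mult[OF _ smooth_on_const[of S "-1::real"], of f] by simp

lemma smooth_on_diff:
  fixes f g :: "'e::real_normed_vector \<Rightarrow> real"
  shows "open S \<Longrightarrow> smooth_on S f \<Longrightarrow> smooth_on S g \<Longrightarrow> smooth_on S (\<lambda>x. f x - g x)"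
  using smooth_on_add[of S f "\<lambda>x. - g x"] smooth_on_minus[of S g] by simp

lemma smooth_on_local:
  assumes "\<And>x. x \<in> S \<Longrightarrow> \<exists>U. open U \<and> x \<in> U \<and> smooth_on U f"
  shows "smooth_on S f"
  unfolding smooth_on_def using assms Ck_local[of S _ f] unfolding smooth_on_def by meson

lemma smooth_on_cong: "open S \<Longrightarrow> (\<And>x. x \<in> S \<Longrightarrow> f x = g x) \<Longrightarrow> smooth_on S f \<Longrightarrow> smooth_on S g"
  using Ck_cong[of S f g] unfolding smooth_on_def by blast

lemma smooth_on_differentiable: "smooth_on S f \<Longrightarrow> x \<in> S \<Longrightarrow> f differentiable at x"
  unfolding smooth_on_def by (meson Ck.simps(2))

lemma smooth_on_frechet_derivative: "smooth_on S f \<Longrightarrow> smooth_on S (\<lambda>x. frechet_derivative f (at x) v)"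
  unfolding smooth_on_def using Ck.simps(2)[of _ S f] by blast

section \<open>Symmetry of second derivatives\<close>

text \<open>
  The mean value theorem, applied in the direction \<open>u\<close> and then in the direction \<open>v\<close>, turns the second
  difference over a parallelogram into \<open>h * h\<close> times a second derivative at an interior point.
\<close>

lemma second_difference_mean_value:
  fixes f :: "'e::real_normed_vector \<Rightarrow> real"
  assumes "smooth_on S f" "h > 0"
    and in_S: "\<And>s t. 0 \<le> s \<Longrightarrow> s \<le> h \<Longrightarrow> 0 \<le> t \<Longrightarrow> t \<le> h \<Longrightarrow> x + s *\<^sub>R u + t *\<^sub>R v \<in> S"
  obtains s t where "0 < s" "s < h" "0 < t" "t < h"
    "f (x + h *\<^sub>R u + h *\<^sub>R v) - f (x + h *\<^sub>R u) - f (x + h *\<^sub>R v) + f x =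
      h * h * frechet_derivative (\<lambda>y. frechet_derivative f (at y) u) (at (x + s *\<^sub>R u + t *\<^sub>R v)) v"
proof -
  define g where "g = (\<lambda>y. frechet_derivative f (at y) u)"
  have line: "((\<lambda>s. F (p + s *\<^sub>R w)) has_real_derivative frechet_derivative F (at (p + s *\<^sub>R w)) w) (at s)"
    if "smooth_on S F" "p + s *\<^sub>R w \<in> S" for F :: "'e \<Rightarrow> real" and p w s
  proof -
    have F: "(F has_derivative frechet_derivative F (at (p + s *\<^sub>R w))) (at (p + s *\<^sub>R w))"
      by (rule differentiable_frechet[OF smooth_on_differentiable[OF that]])
    have "((\<lambda>s. p + s *\<^sub>R w) has_derivative (\<lambda>r. r *\<^sub>R w)) (at s)"
      by (auto intro!: derivative_eq_intros)
    from has_derivative_compose[OF this F]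
    have "((\<lambda>s. F (p + s *\<^sub>R w)) has_derivative (\<lambda>r. frechet_derivative F (at (p + s *\<^sub>R w)) (r *\<^sub>R w))) (at s)" .
    moreover have "frechet_derivative F (at (p + s *\<^sub>R w)) (r *\<^sub>R w) = frechet_derivative F (at (p + s *\<^sub>R w)) w * r" for r
      using linear_scale[OF has_derivative_linear[OF F]] by (simp add: mult.commute)
    ultimately show ?thesis by (simp add: has_field_derivative_def)
  qed
  have sg: "smooth_on S g" unfolding g_def by (rule smooth_on_frechet_derivative[OF assms(1)])
  define k where "k s = f (x + h *\<^sub>R v + s *\<^sub>R u) - f (x + s *\<^sub>R u)" for s
  have dk: "(k has_real_derivative g (x + h *\<^sub>R v + s *\<^sub>R u) - g (x + s *\<^sub>R u)) (at s)" if "0 \<le> s" "s \<le> h" for s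
    unfolding k_def g_def using in_S[of s h] in_S[of s 0] that assms(2)
    by (intro DERIV_diff line[OF assms(1)]) (simp_all add: algebra_simps)
  obtain s where s: "0 < s" "s < h" and ks: "k h - k 0 = h * (g (x + h *\<^sub>R v + s *\<^sub>R u) - g (x + s *\<^sub>R u))"
    using MVT2[OF assms(2), of k "\<lambda>s. g (x + h *\<^sub>R v + s *\<^sub>R u) - g (x + s *\<^sub>R u)"] dk by auto
  define l where "l t = g (x + s *\<^sub>R u + t *\<^sub>R v)" for t
  have dl: "(l has_real_derivative frechet_derivative g (at (x + s *\<^sub>R u + t *\<^sub>R v)) v) (at t)" if "0 \<le> t" "t \<le> h" for t
    unfolding l_def using in_S[of s t] that s by (intro line[OF sg]) simp
  obtain t where t: "0 < t" "t < h" and lt: "l h - l 0 = h * frechet_derivative g (at (x + s *\<^sub>R u + t *\<^sub>R v)) v"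
    using MVT2[OF assms(2), of l "\<lambda>t. frechet_derivative g (at (x + s *\<^sub>R u + t *\<^sub>R v)) v"] dl by auto
  have "f (x + h *\<^sub>R u + h *\<^sub>R v) - f (x + h *\<^sub>R u) - f (x + h *\<^sub>R v) + f x = k h - k 0"
    by (simp add: k_def algebra_simps)
  also have "\<dots> = h * (l h - l 0)" by (simp add: ks l_def algebra_simps)
  also have "\<dots> = h * h * frechet_derivative g (at (x + s *\<^sub>R u + t *\<^sub>R v)) v" by (simp add: lt)
  finally show ?thesis using that s t unfolding g_def by blast
qed

text \<open>
  The second difference is symmetric in \<open>u\<close> and \<open>v\<close>. If the two mixed derivatives at \<open>x\<close> differed, then
  by continuity their values in a small ball would be disjoint, but the second difference over a small
  parallelogram is proportional, with the same factor, to a value of each.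
\<close>

lemma frechet_derivative_symmetric:
  fixes f :: "'e::real_normed_vector \<Rightarrow> real"
  assumes f: "smooth_on S f" and S: "open S" "x \<in> S"
  shows "frechet_derivative (\<lambda>y. frechet_derivative f (at y) u) (at x) v =
    frechet_derivative (\<lambda>y. frechet_derivative f (at y) v) (at x) u"
proof (rule ccontr)
  define A where "A u v y = frechet_derivative (\<lambda>y. frechet_derivative f (at y) u) (at y) v" for u v y
  assume "\<not> ?thesis"
  hence ne: "A u v x \<noteq> A v u x" by (simp add: A_def)
  define r where "r = \<bar>A u v x - A v u x\<bar> / 2"
  have r: "r > 0" using ne by (simp add: r_def)
  have "continuous_on S (A u v)" for u v
    unfolding A_def using smooth_on_frechet_derivative[OF smooth_on_frechet_derivative[OF f]]
    by (metis smooth_on_def Ck.simps(1))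
  hence "isCont (A u v) x" for u v using S by (simp add: continuous_on_eq_continuous_at)
  hence "\<exists>d>0. \<forall>y. dist y x < d \<longrightarrow> dist (A u v y) (A u v x) < r" for u v
    using r unfolding continuous_at_eps_delta by blast
  then obtain d1 d2 where d1: "d1 > 0" "\<And>y. dist y x < d1 \<Longrightarrow> dist (A u v y) (A u v x) < r"
    and d2: "d2 > 0" "\<And>y. dist y x < d2 \<Longrightarrow> dist (A v u y) (A v u x) < r" by metis
  obtain d3 where d3: "d3 > 0" "\<And>y. dist y x < d3 \<Longrightarrow> y \<in> S" using S open_dist by metis
  define d where "d = Min {d1, d2, d3}"
  have d: "d > 0" "d \<le> d1" "d \<le> d2" "d \<le> d3" using d1 d2 d3 by (auto simp: d_def)
  define h where "h = d / (norm u + norm v + 1)"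
  have pos: "norm u + norm v + 1 > 0" by (simp add: add_nonneg_pos)
  have h: "h > 0" using d pos by (simp add: h_def)
  have near: "dist (x + s *\<^sub>R u' + t *\<^sub>R v') x < d"
    if "0 \<le> s" "s \<le> h" "0 \<le> t" "t \<le> h" "norm u' + norm v' = norm u + norm v" for s t u' v'
  proof -
    have "dist (x + s *\<^sub>R u' + t *\<^sub>R v') x = norm (s *\<^sub>R u' + t *\<^sub>R v')" by (simp add: dist_norm)
    also have "\<dots> \<le> s * norm u' + t * norm v'" using norm_triangle_ineq[of "s *\<^sub>R u'" "t *\<^sub>R v'"] that by simp
    also have "\<dots> \<le> h * norm u' + h * norm v'" using that by (intro add_mono mult_right_mono) auto
    also have "\<dots> = h * (norm u + norm v)" using that by (simp flip: distrib_left)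
    also have "\<dots> < h * (norm u + norm v + 1)" using h by simp
    also have "\<dots> = d" using pos by (simp add: h_def)
    finally show ?thesis .
  qed
  have inS: "x + s *\<^sub>R u' + t *\<^sub>R v' \<in> S"
    if "0 \<le> s" "s \<le> h" "0 \<le> t" "t \<le> h" "norm u' + norm v' = norm u + norm v" for s t u' v'
    using near[OF that] d(4) by (intro d3(2)) linarith
  obtain s t where 1: "0 < s" "s < h" "0 < t" "t < h"
    "f (x + h *\<^sub>R u + h *\<^sub>R v) - f (x + h *\<^sub>R u) - f (x + h *\<^sub>R v) + f x = h * h * A u v (x + s *\<^sub>R u + t *\<^sub>R v)"
    unfolding A_def
    by (rule second_difference_mean_value[OF f h, of x u v]) (rule inS, simp_all)
  obtain s' t' where 2: "0 < s'" "s' < h" "0 < t'" "t' < h"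
    "f (x + h *\<^sub>R v + h *\<^sub>R u) - f (x + h *\<^sub>R v) - f (x + h *\<^sub>R u) + f x = h * h * A v u (x + s' *\<^sub>R v + t' *\<^sub>R u)"
    unfolding A_def
    by (rule second_difference_mean_value[OF f h, of x v u]) (rule inS, simp_all)
  have "h * h * A u v (x + s *\<^sub>R u + t *\<^sub>R v) = h * h * A v u (x + s' *\<^sub>R v + t' *\<^sub>R u)"
    using 1(5) 2(5) unfolding add.commute[of "x + h *\<^sub>R v"] add.assoc[of x] add.commute[of "h *\<^sub>R u" "h *\<^sub>R v"] by linarith
  hence "A u v (x + s *\<^sub>R u + t *\<^sub>R v) = A v u (x + s' *\<^sub>R v + t' *\<^sub>R u)" using h by simp
  moreover have "dist (A u v (x + s *\<^sub>R u + t *\<^sub>R v)) (A u v x) < r"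
    using near[of s t u v] 1 d by (intro d1) simp
  moreover have "dist (A v u (x + s' *\<^sub>R v + t' *\<^sub>R u)) (A v u x) < r"
    using near[of s' t' v u] 2 d by (intro d2) simp
  ultimately show False unfolding r_def dist_real_def by (simp add: field_simps abs_if split: if_splits)
qed

section \<open>From $SU(3)$ coframes to $G_2$ coframes\<close>

lemma alt_form_pullback:
  assumes "alt_form k \<omega>" "linear L"
  shows "alt_form k (\<lambda>vs. \<omega> (map L vs))"
  unfolding alt_form_def
proof (intro conjI allI impI)
  fix vs :: "'b list" and i assume i: "length vs = k \<and> i < k"
  hence "linear (\<lambda>v. \<omega> ((map L vs)[i := v]))" using assms(1) by (intro alt_form_linear_update) auto
  from linear_compose[OF assms(2) this] show "linear (\<lambda>v. \<omega> (map L (vs[i := v])))"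
    by (simp add: map_update o_def)
next
  fix vs :: "'b list" assume "length vs = k \<and> \<not> distinct vs"
  hence "\<not> distinct (map L vs)" by (simp add: distinct_map)
  thus "\<omega> (map L vs) = 0" by (rule alt_form_not_distinct[OF assms(1)])
qed (simp add: alt_form_eq_0[OF assms(1)])

lemma wedge_1_1_1:
  fixes \<alpha> \<beta> \<gamma> :: "'e list \<Rightarrow> 'r::comm_ring_1"
  assumes "of_degree 1 \<alpha>" "of_degree 1 \<beta>" "of_degree 1 \<gamma>"
  shows "wedge (wedge \<alpha> \<beta>) \<gamma> [u, v, w] =
    (\<alpha> [u] * \<beta> [v] - \<alpha> [v] * \<beta> [u]) * \<gamma> [w] - (\<alpha> [u] * \<beta> [w] - \<alpha> [w] * \<beta> [u]) * \<gamma> [v]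
    + (\<alpha> [v] * \<beta> [w] - \<alpha> [w] * \<beta> [v]) * \<gamma> [u]"
proof -
  have z: "\<alpha> [] = 0" "\<beta> [] = 0" "\<gamma> [] = 0" "\<alpha> (x # y # xs) = 0" "\<beta> (x # y # xs) = 0" "\<gamma> (x # y # xs) = 0" for x y xs
    using assms by (auto simp: of_degree_def)
  show ?thesis by (simp add: wedge_Cons z algebra_simps)
qed

lemma wedge_2_2:
  fixes \<alpha> :: "'e list \<Rightarrow> 'r::comm_ring_1"
  assumes "of_degree 2 \<alpha>"
  shows "wedge \<alpha> \<alpha> [u, v, w, z] =
    2 * (\<alpha> [u, v] * \<alpha> [w, z] - \<alpha> [u, w] * \<alpha> [v, z] + \<alpha> [u, z] * \<alpha> [v, w])"
proof -
  have z: "\<alpha> [] = 0" "\<alpha> [x] = 0" "\<alpha> (x # y # y' # xs) = 0" for x y y' xs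
    using assms by (auto simp: of_degree_def)
  show ?thesis by (simp add: wedge_Cons z algebra_simps)
qed

lemma wedge_2_dq:
  assumes "of_degree 2 \<alpha>"
  shows "wedge \<alpha> (dq d z) [u, v, w] = \<alpha> [u, v] * snd w - \<alpha> [u, w] * snd v + \<alpha> [v, w] * snd u"
proof -
  have z: "\<alpha> [] = 0" "\<alpha> [x] = 0" "\<alpha> (x # y # y' # xs) = 0" for x y y' xs
    using assms by (auto simp: of_degree_def)
  show ?thesis by (simp add: wedge_Cons z dq_def algebra_simps)
qed

lemma wedge_3_dq:
  assumes "of_degree 3 \<alpha>"
  shows "wedge \<alpha> (dq d z) [u, v, w, x] = \<alpha> [u, v, w] * snd x - \<alpha> [u, v, x] * snd w + \<alpha> [u, w, x] * snd v - \<alpha> [v, w, x] * snd u"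
proof -
  have z: "\<alpha> [] = 0" "\<alpha> [x] = 0" "\<alpha> [x, y] = 0" "\<alpha> (x # y # y' # y'' # xs) = 0" for x y y' y'' xs
    using assms by (auto simp: of_degree_def)
  show ?thesis by (simp add: wedge_Cons z dq_def algebra_simps)
qed

lemma alt_form_dq: "alt_form 1 (dq d z)"
  unfolding alt_form_def
proof (intro conjI allI impI)
  fix vs :: "('a \<times> real) list" and k :: nat assume "length vs = 1 \<and> k < 1"
  then obtain w where "vs = [w]" "k = 0" by (auto simp: length_Suc_conv)
  thus "linear (\<lambda>v. dq d z (vs[k := v]))" by (simp add: dq_def linear_snd)
qed (auto simp: dq_def length_Suc_conv split: list.splits)

lemma su3_coframe_alt1:
  assumes "su3_coframe e F P N" "i \<in> {1..6}"
  shows "alt_form 1 (e i)"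
  using assms unfolding su3_coframe_def coframe_def by blast

lemma su3_coframe_deg:
  assumes "su3_coframe e F P N"
  shows "of_degree 1 (e 1)" "of_degree 1 (e 2)" "of_degree 1 (e 3)" "of_degree 1 (e 4)"
     "of_degree 1 (e 5)" "of_degree 1 (e 6)"
  using su3_coframe_alt1[OF assms] by (auto intro!: alt_form_of_degree)

lemma su3_coframe_F:
  assumes "su3_coframe e F P N"
  shows "F [u, v] = e 1 [u] * e 2 [v] - e 1 [v] * e 2 [u] + (e 3 [u] * e 4 [v] - e 3 [v] * e 4 [u])
    + (e 5 [u] * e 6 [v] - e 5 [v] * e 6 [u])"
  using assms su3_coframe_deg[OF assms] by (simp add: su3_coframe_def ewedge_1 ewedge_2)

text \<open>
  The determinant of the complex 1-forms $e^1 + ie^2$, $e^3 + ie^4$, $e^5 + ie^6$, expanded along the last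
  one.
\<close>

definition complex_volume :: "(nat \<Rightarrow> 'e list \<Rightarrow> real) \<Rightarrow> 'e \<Rightarrow> 'e \<Rightarrow> 'e \<Rightarrow> complex" where
  "complex_volume e u v w =
      (Complex (e 1 [u]) (e 2 [u]) * Complex (e 3 [v]) (e 4 [v]) - Complex (e 1 [v]) (e 2 [v]) * Complex (e 3 [u]) (e 4 [u])) * Complex (e 5 [w]) (e 6 [w])
      - (Complex (e 1 [u]) (e 2 [u]) * Complex (e 3 [w]) (e 4 [w]) - Complex (e 1 [w]) (e 2 [w]) * Complex (e 3 [u]) (e 4 [u])) * Complex (e 5 [v]) (e 6 [v])
      + (Complex (e 1 [v]) (e 2 [v]) * Complex (e 3 [w]) (e 4 [w]) - Complex (e 1 [w]) (e 2 [w]) * Complex (e 3 [v]) (e 4 [v])) * Complex (e 5 [u]) (e 6 [u])"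

lemma su3_coframe_\<Psi>:
  assumes "su3_coframe e F P N"
  shows "length vs \<noteq> 3 \<Longrightarrow> P vs = 0" "length vs \<noteq> 3 \<Longrightarrow> N vs = 0"
    "P [u, v, w] = Re (complex_volume e u v w)" "N [u, v, w] = Im (complex_volume e u v w)"
proof -
  have \<Psi>: "Complex (P vs) (N vs) = wedge (wedge (\<lambda>vs. Complex (e 1 vs) (e 2 vs)) (\<lambda>vs. Complex (e 3 vs) (e 4 vs)))
         (\<lambda>vs. Complex (e 5 vs) (e 6 vs)) vs" for vs
    using assms fun_cong[of "\<lambda>vs. Complex (P vs) (N vs)"] unfolding su3_coframe_def by blast
  have deg: "of_degree 1 (\<lambda>vs. Complex (e i vs) (e j vs))" if "of_degree 1 (e i)" "of_degree 1 (e j)" for i j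
    using that by (auto simp: of_degree_def complex_eq_iff)
  note d = su3_coframe_deg[OF assms]
  have "of_degree (1 + 1 + 1) (wedge (wedge (\<lambda>vs. Complex (e 1 vs) (e 2 vs)) (\<lambda>vs. Complex (e 3 vs) (e 4 vs)))
         (\<lambda>vs. Complex (e 5 vs) (e 6 vs)))"
    by (intro of_degree_wedge deg d)
  hence "Complex (P vs) (N vs) = 0" if "length vs \<noteq> 3" for vs
    using that unfolding \<Psi> of_degree_def by simp
  thus "length vs \<noteq> 3 \<Longrightarrow> P vs = 0" "length vs \<noteq> 3 \<Longrightarrow> N vs = 0" by (auto simp: complex_eq_iff)
  have "Complex (P [u, v, w]) (N [u, v, w]) = complex_volume e u v w"
    unfolding \<Psi> complex_volume_def by (rule wedge_1_1_1[OF deg[OF d(1,2)] deg[OF d(3,4)] deg[OF d(5,6)]])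
  thus "P [u, v, w] = Re (complex_volume e u v w)" "N [u, v, w] = Im (complex_volume e u v w)"
    by (metis complex.sel)+
qed

text \<open>
  Multiplying $e^1 + ie^2$ by \<open>i\<close> replaces $(e^1, e^2)$ by $(-e^2, e^1)$. It fixes \<open>F\<close> and turns $\Psi_+$ into
  $-\Psi_-$, so $F \wedge dq - \Psi_-$ takes the model form. The covector of index 7 is \<open>dq\<close>.
\<close>

definition cyl_coframe :: "(nat \<Rightarrow> 'e list \<Rightarrow> real) \<Rightarrow> nat \<Rightarrow> ('e \<times> real) list \<Rightarrow> real" where
  "cyl_coframe e i vs =
     (if i = 1 then - e 2 (map fst vs) else if i = 2 then e 1 (map fst vs)
      else if i = 7 then (case vs of [v] \<Rightarrow> snd v | _ \<Rightarrow> 0) else e i (map fst vs))"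

lemma coframe_cyl_coframe:
  fixes e :: "nat \<Rightarrow> (real^6) list \<Rightarrow> real"
  assumes "coframe 6 e"
  shows "coframe 7 (cyl_coframe e)"
  unfolding coframe_def
proof (intro conjI ballI allI impI)
  have alt: "alt_form 1 (e i)" if "i \<in> {1..6}" for i using assms that unfolding coframe_def by blast
  have pb: "alt_form 1 (\<lambda>vs::((real^6) \<times> real) list. e i (map fst vs))" if "i \<in> {1..6}" for i
    by (rule alt_form_pullback[OF alt[OF that] linear_fst])
  show "DIM((real^6) \<times> real) = 7" by simp
  show "alt_form 1 (cyl_coframe e i)" if i: "i \<in> {1..7}" for i
  proof -
    consider "i = 1" | "i = 2" | "i = 7" | "i \<in> {3..6}" using i by force
    thus ?thesis
    proof cases
      case 1
      have "alt_form 1 (\<lambda>vs::((real^6) \<times> real) list. - 1 * e 2 (map fst vs))"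
        by (intro alt_form_scale pb) simp
      thus ?thesis using 1 by (simp add: cyl_coframe_def[abs_def])
    next
      case 2 thus ?thesis using pb[of 1] by (simp add: cyl_coframe_def[abs_def])
    next
      case 3 
      have "cyl_coframe e i = dq undefined undefined" using 3 by (intro ext) (simp add: cyl_coframe_def dq_def)
      thus ?thesis using alt_form_dq by metis
    next
      case 4 
      hence "cyl_coframe e i = (\<lambda>vs. e i (map fst vs))" by (intro ext) (auto simp: cyl_coframe_def)
      thus ?thesis using pb[of i] 4 by simp
    qed
  qed
  \<comment> \<open>A relation is evaluated first on the \<open>q\<close>-direction, and then on vectors tangent to \<open>M\<close>.\<close>
  fix a :: "nat \<Rightarrow> real" and i :: nat
  assume z: "\<forall>v. (\<Sum>i=1..7. a i * cyl_coframe e i [v]) = 0" and i: "i \<in> {1..7}"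
  have e0: "e i [0] = 0" if "i \<in> {1..6}" for i
    using linear_0[OF alt_form_linear_Cons[OF alt[OF that]]] .
  have "(\<Sum>i=1..7. a i * cyl_coframe e i [(0, 1)]) = a 7"
    unfolding sum_1_7 using e0 by (simp add: cyl_coframe_def)
  hence a7: "a 7 = 0" using z by simp
  define a' where "a' = (\<lambda>i. if i = 1 then a 2 else if i = 2 then - a 1 else a i)"
  have "(\<Sum>i=1..6. a' i * e i [v]) = (\<Sum>i=1..7. a i * cyl_coframe e i [(v, 0)])" for v
    unfolding sum_1_7 by (simp add: eval_nat_numeral cyl_coframe_def a'_def)
  hence "\<forall>v. (\<Sum>i=1..6. a' i * e i [v]) = 0" using z by simp
  hence "\<forall>i\<in>{1..6}. a' i = 0" using assms unfolding coframe_def by blast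
  hence "a' 1 = 0" "a' 2 = 0" "a' 3 = 0" "a' 4 = 0" "a' 5 = 0" "a' 6 = 0" by simp_all
  hence "a 1 = 0" "a 2 = 0" "a 3 = 0" "a 4 = 0" "a 5 = 0" "a 6 = 0" by (simp_all add: a'_def)
  moreover have "i = 1 \<or> i = 2 \<or> i = 3 \<or> i = 4 \<or> i = 5 \<or> i = 6 \<or> i = 7" using i by force
  ultimately show "a i = 0" using a7 by metis
qed

text \<open>
  On lists of the right length, where the two sides do not vanish trivially, both parts are polynomial
  identities in the coordinates. They give the formula ${*}\phi = \frac12 F \wedge F + \Psi_+ \wedge dq$.
\<close>

lemma su3_coframe_g2:
  fixes e :: "nat \<Rightarrow> (real^6) list \<Rightarrow> real"
  assumes su3: "su3_coframe e F P N"
  shows "g2_coframe (cyl_coframe e) (\<lambda>vs. wedge (\<lambda>vs. F (map fst vs)) (dq d z) vs - N (map fst vs))"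
    and "g2_dual (cyl_coframe e) vs = 1/2 * wedge F F (map fst vs) + wedge (\<lambda>vs. P (map fst vs)) (dq d z) vs"
proof -
  have cof: "coframe 7 (cyl_coframe e)" using su3 by (simp add: su3_coframe_def coframe_cyl_coframe)
  define f where "f = cyl_coframe e"
  have f: "f 1 [v] = - e 2 [fst v]" "f 2 [v] = e 1 [fst v]" "f 3 [v] = e 3 [fst v]" "f 4 [v] = e 4 [fst v]"
    "f 5 [v] = e 5 [fst v]" "f 6 [v] = e 6 [fst v]" "f 7 [v] = snd v" for v
    by (simp_all add: f_def cyl_coframe_def)
  have alt: "alt_form 1 (f i)" if "i \<in> {1..7}" for i using cof that unfolding coframe_def f_def by blast
  hence deg: "of_degree 1 (f 1)" "of_degree 1 (f 2)" "of_degree 1 (f 3)" "of_degree 1 (f 4)"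
     "of_degree 1 (f 5)" "of_degree 1 (f 6)" "of_degree 1 (f 7)"
    by (auto intro!: alt_form_of_degree)
  have altew: "alt_form (length is) (ewedge f is)" if "set is \<subseteq> {1..7}" for "is"
    using alt that by (intro alt_form_ewedge) auto
  have dF: "of_degree 2 F"
  proof -
    have "of_degree 2 (ewedge e [i, j])" if "i \<in> {1..6}" "j \<in> {1..6}" for i j
      by (rule alt_form_of_degree[OF alt_form_ewedge]) (use su3_coframe_alt1[OF su3] that in auto)
    moreover have "F = (\<lambda>vs. ewedge e [1,2] vs + ewedge e [3,4] vs + ewedge e [5,6] vs)"
      using su3 by (simp add: su3_coframe_def)
    ultimately show ?thesis by (simp add: of_degree_def)
  qed
  hence dF': "of_degree 2 (\<lambda>vs::((real^6) \<times> real) list. F (map fst vs))" by (simp add: of_degree_def)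
  have dP: "of_degree 3 (\<lambda>vs::((real^6) \<times> real) list. P (map fst vs))"
    using su3_coframe_\<Psi>[OF su3] by (simp add: of_degree_def)
  have ddq: "of_degree 1 (dq d z)" by (rule alt_form_of_degree[OF alt_form_dq])
  show "g2_coframe (cyl_coframe e) (\<lambda>vs. wedge (\<lambda>vs. F (map fst vs)) (dq d z) vs - N (map fst vs))"
    unfolding g2_coframe_def f_def[symmetric]
  proof (intro conjI ext)
    show "coframe 7 f" using cof by (simp add: f_def)
    fix vs :: "((real^6) \<times> real) list"
    show "wedge (\<lambda>vs. F (map fst vs)) (dq d z) vs - N (map fst vs) =
       ewedge f [1, 2, 7] vs + ewedge f [3, 4, 7] vs + ewedge f [5, 6, 7] vs + ewedge f [1, 3, 5] vs -
       ewedge f [1, 4, 6] vs - ewedge f [2, 3, 6] vs - ewedge f [2, 4, 5] vs"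
    proof (cases "length vs = 3")
      case True
      then obtain u v w where vs: "vs = [u, v, w]" by (auto simp: eval_nat_numeral length_Suc_conv)
      show ?thesis unfolding vs wedge_2_dq[OF dF'] list.map su3_coframe_\<Psi>(3,4)[OF su3] complex_volume_def su3_coframe_F[OF su3]
        using f deg by (simp add: ewedge_expand algebra_simps)
    next
      case False
      have "ewedge f [i,j,k] vs = 0" if "{i, j, k} \<subseteq> {1..7}" for i j k
        using altew[of "[i,j,k]"] that False by (intro alt_form_eq_0[of 3]) (auto simp: eval_nat_numeral)
      moreover have "wedge (\<lambda>vs. F (map fst vs)) (dq d z) vs = 0"
        using wedge_eq_0[OF dF' ddq] False by simp
      moreover have "N (map fst vs) = 0" using su3_coframe_\<Psi>(2)[OF su3, of "map fst vs"] False by simp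
      ultimately show ?thesis by simp
    qed
  qed
  show "g2_dual (cyl_coframe e) vs = 1/2 * wedge F F (map fst vs) + wedge (\<lambda>vs. P (map fst vs)) (dq d z) vs"
    unfolding f_def[symmetric]
  proof (cases "length vs = 4")
    case True
    then obtain u v w x where vs: "vs = [u, v, w, x]" by (auto simp: eval_nat_numeral length_Suc_conv)
    show "g2_dual f vs = 1/2 * wedge F F (map fst vs) + wedge (\<lambda>vs. P (map fst vs)) (dq d z) vs" 
      unfolding vs wedge_3_dq[OF dP] list.map wedge_2_2[OF dF] su3_coframe_\<Psi>(3,4)[OF su3] complex_volume_def su3_coframe_F[OF su3] g2_dual_def
      using f deg by (simp add: ewedge_expand algebra_simps)
  next
    case False
    have "ewedge f [i,j,k,l] vs = 0" if "{i, j, k,l} \<subseteq> {1..7}" for i j k l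
      using altew[of "[i,j,k,l]"] that False by (intro alt_form_eq_0[of 4]) (auto simp: eval_nat_numeral)
    moreover have "wedge (\<lambda>vs. P (map fst vs)) (dq d z) vs = 0"
      using wedge_eq_0[OF dP ddq] False by simp
    moreover have "wedge F F (map fst vs) = 0" using wedge_eq_0[OF dF dF] False by simp
    ultimately show "g2_dual f vs = 1/2 * wedge F F (map fst vs) + wedge (\<lambda>vs. P (map fst vs)) (dq d z) vs" 
      by (simp add: g2_dual_def)
  qed
qed

section \<open>Exterior derivatives on a chart\<close>

lemma ext_d_3:
  "ext_d \<omega> c y [u, v, w] =
    frechet_derivative (\<lambda>z. \<omega> c z [v, w]) (at y) u - frechet_derivative (\<lambda>z. \<omega> c z [u, w]) (at y) v
    + frechet_derivative (\<lambda>z. \<omega> c z [u, v]) (at y) w"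
  by (simp add: ext_d_def eval_nat_numeral)

lemma ext_d_4:
  "ext_d \<omega> c y [u, v, w, x] =
    frechet_derivative (\<lambda>z. \<omega> c z [v, w, x]) (at y) u - frechet_derivative (\<lambda>z. \<omega> c z [u, w, x]) (at y) v
    + frechet_derivative (\<lambda>z. \<omega> c z [u, v, x]) (at y) w - frechet_derivative (\<lambda>z. \<omega> c z [u, v, w]) (at y) x"
  by (simp add: ext_d_def eval_nat_numeral)

lemma ext_d_cong_open:
  assumes "open U" "y \<in> U" "\<And>z. z \<in> U \<Longrightarrow> \<alpha> c z = \<beta> c z"
  shows "ext_d \<alpha> c y vs = ext_d \<beta> c y vs"
proof -
  have "frechet_derivative (\<lambda>z. \<alpha> c z ws) (at y) = frechet_derivative (\<lambda>z. \<beta> c z ws) (at y)" for ws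
    using assms(3) by (intro frechet_derivative_cong_open[OF assms(1,2)]) simp
  thus ?thesis by (simp add: ext_d_def)
qed

lemma ext_d_wrong_degree:
  assumes "open U" "y \<in> U" "\<And>z. z \<in> U \<Longrightarrow> of_degree k (\<omega> c z)" "length vs \<noteq> Suc k"
  shows "ext_d \<omega> c y vs = 0"
proof -
  have "frechet_derivative (\<lambda>z. \<omega> c z (take i vs @ drop (Suc i) vs)) (at y) = (\<lambda>_. 0)" if "i < length vs" for i
  proof -
    have "length (take i vs @ drop (Suc i) vs) \<noteq> k" using that assms(4) by auto
    hence "frechet_derivative (\<lambda>z. \<omega> c z (take i vs @ drop (Suc i) vs)) (at y) = frechet_derivative (\<lambda>z. 0) (at y)"
      using assms(3) by (intro frechet_derivative_cong_open[OF assms(1,2)]) (simp add: of_degree_def)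
    thus ?thesis by simp
  qed
  thus ?thesis by (simp add: ext_d_def)
qed

lemma frechet_derivative_diff_add:
  fixes f g h :: "'e::real_normed_vector \<Rightarrow> real"
  assumes "f differentiable at x" "g differentiable at x" "h differentiable at x"
  shows "frechet_derivative (\<lambda>z. f z - g z + h z) (at x) v =
    frechet_derivative f (at x) v - frechet_derivative g (at x) v + frechet_derivative h (at x) v"
  using has_derivative_add[OF has_derivative_diff[OF assms(1,2)[THEN differentiable_frechet]] assms(3)[THEN differentiable_frechet]]
  by (simp add: frechet_derivative_eqI)

text \<open>
  The twelve second derivatives cancel in pairs. Only forms of degree 2 occur here, as \<open>F\<close> is the only form
  that is differentiated twice.
\<close>

lemma ext_d_ext_d:
  fixes \<omega> :: "('a, 'e::euclidean_space) dform"
  assumes U: "open U" "y \<in> U" and sm: "\<And>vs. smooth_on U (\<lambda>z. \<omega> c z vs)"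
  shows "ext_d (ext_d \<omega>) c y [u, v, w, x] = 0"
proof -
  have diff: "(\<lambda>z. frechet_derivative (\<lambda>z. \<omega> c z vs) (at z) r) differentiable at y" for vs r
    by (rule smooth_on_differentiable[OF smooth_on_frechet_derivative[OF sm] U(2)])
  have sym: "frechet_derivative (\<lambda>z. frechet_derivative (\<lambda>z. \<omega> c z vs) (at z) r) (at y) s
      = frechet_derivative (\<lambda>z. frechet_derivative (\<lambda>z. \<omega> c z vs) (at z) s) (at y) r" for vs r s
    by (rule frechet_derivative_symmetric[OF sm U])
  show ?thesis
    unfolding ext_d_4[of "ext_d \<omega>"] ext_d_3 frechet_derivative_diff_add[OF diff diff diff]
    using sym[of _ u] sym[of _ v w] sym[of _ v x] sym[of _ w x] by simp
qed

section \<open>Families depending on a parameter\<close>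

lemma joint_derivative:
  fixes f :: "'e::euclidean_space \<times> real \<Rightarrow> real"
  assumes "f differentiable at (y, q)"
  shows "(\<lambda>z. f (z, q)) differentiable at y"
    and "((\<lambda>s. f (y, s)) has_real_derivative frechet_derivative f (at (y, q)) (0, 1)) (at q)"
    and "frechet_derivative f (at (y, q)) (x, t) =
      frechet_derivative (\<lambda>z. f (z, q)) (at y) x + t * deriv (\<lambda>s. f (y, s)) q"
proof -
  let ?D = "frechet_derivative f (at (y, q))"
  have D: "(f has_derivative ?D) (at (y, q))" by (rule differentiable_frechet[OF assms])
  have lin: "linear ?D" using D by (rule has_derivative_linear)
  have "((\<lambda>z. (z, q)) has_derivative (\<lambda>h. (h, 0))) (at y)"
    by (auto intro!: derivative_eq_intros)
  from has_derivative_compose[OF this D]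
  have 1: "((\<lambda>z. f (z, q)) has_derivative (\<lambda>h. ?D (h, 0))) (at y)" .
  thus "(\<lambda>z. f (z, q)) differentiable at y" by (rule differentiableI)
  have "((\<lambda>s. (y, s)) has_derivative (\<lambda>r. (0, r))) (at q)"
    by (auto intro!: derivative_eq_intros)
  from has_derivative_compose[OF this D]
  have 2: "((\<lambda>s. f (y, s)) has_derivative (\<lambda>r. ?D (0, r))) (at q)" .
  have r: "?D (0, r) = r * ?D (0, 1)" for r
    using linear_scale[OF lin, of r "(0, 1)"] by simp
  have "(\<lambda>r. ?D (0, r)) = (*) (?D (0, 1))" by (intro ext) (subst r, simp)
  with 2 show 3: "((\<lambda>s. f (y, s)) has_real_derivative ?D (0, 1)) (at q)"
    by (simp add: has_field_derivative_def)
  have "?D (x, t) = ?D (x, 0) + ?D (0, t)" using linear_add[OF lin, of "(x, 0)" "(0, t)"] by simp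
  also have "?D (x, 0) = frechet_derivative (\<lambda>z. f (z, q)) (at y) x"
    using frechet_derivative_eqI[OF 1] by simp
  also have "?D (0, t) = t * deriv (\<lambda>s. f (y, s)) q" 
    unfolding DERIV_imp_deriv[OF 3] by (rule r)
  finally show "?D (x, t) = frechet_derivative (\<lambda>z. f (z, q)) (at y) x + t * deriv (\<lambda>s. f (y, s)) q" .
qed

text \<open>
  Both derivatives are directional derivatives of the joint function \<open>f\<close>, in the directions \<open>(0, 1)\<close> and
  \<open>(v, 0)\<close>.
\<close>

lemma derivatives_commute:
  fixes f :: "'e::euclidean_space \<times> real \<Rightarrow> real"
  assumes U: "open U" "y \<in> U" and f: "smooth_on (U \<times> UNIV) f"
  shows "(\<lambda>z. deriv (\<lambda>s. f (z, s)) q) differentiable at y"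
    and "((\<lambda>s. frechet_derivative (\<lambda>z. f (z, s)) (at y) v) has_real_derivative
      frechet_derivative (\<lambda>z. deriv (\<lambda>s. f (z, s)) q) (at y) v) (at q)"
proof -
  have op: "open (U \<times> (UNIV :: real set))" using U by (simp add: open_Times)
  have diff: "f differentiable at (z, s)" if "z \<in> U" for z s
    using smooth_on_differentiable[OF f, of "(z, s)"] that by simp
  define g where "g z = frechet_derivative f (at z) (v, 0)" for z
  define h where "h z = frechet_derivative f (at z) (0, 1)" for z
  have g: "g (y, s) = frechet_derivative (\<lambda>z. f (z, s)) (at y) v" for s
    using joint_derivative(3)[OF diff[OF U(2)], of s v 0] by (simp add: g_def)
  have h: "h (z, s) = deriv (\<lambda>s. f (z, s)) s" if "z \<in> U" for z s
    using DERIV_imp_deriv[OF joint_derivative(2)[OF diff[OF that, of s]]] by (simp add: h_def)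
  have dg: "g differentiable at (y, q)" and dh: "h differentiable at (y, q)"
    unfolding g_def h_def
    by (rule smooth_on_differentiable[OF smooth_on_frechet_derivative[OF f]], simp add: U)+
  have "frechet_derivative (\<lambda>z. h (z, q)) (at y) = frechet_derivative (\<lambda>z. deriv (\<lambda>s. f (z, s)) q) (at y)"
    by (rule frechet_derivative_cong_open[OF U]) (simp add: h)
  hence "frechet_derivative h (at (y, q)) (v, 0) = frechet_derivative (\<lambda>z. deriv (\<lambda>s. f (z, s)) q) (at y) v"
    using joint_derivative(3)[OF dh, of v 0] by simp
  moreover have "frechet_derivative g (at (y, q)) (0, 1) = frechet_derivative h (at (y, q)) (v, 0)"
    unfolding g_def[abs_def] h_def[abs_def] by (rule frechet_derivative_symmetric[OF f op]) (simp add: U)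
  ultimately show "((\<lambda>s. frechet_derivative (\<lambda>z. f (z, s)) (at y) v) has_real_derivative
      frechet_derivative (\<lambda>z. deriv (\<lambda>s. f (z, s)) q) (at y) v) (at q)"
    using joint_derivative(2)[OF dg] by (simp add: g)
  show "(\<lambda>z. deriv (\<lambda>s. f (z, s)) q) differentiable at y"
    by (rule differentiable_cong_open[OF U _ joint_derivative(1)[OF dh]]) (simp add: h)
qed

lemma ext_d_d_dq_commute:
  fixes \<alpha> :: "real \<Rightarrow> ('a, 'e::euclidean_space) dform"
  assumes U: "open U" "y \<in> U" and sm: "\<And>vs. smooth_on (U \<times> UNIV) (\<lambda>z. \<alpha> (snd z) c (fst z) vs)"
  shows "((\<lambda>s. ext_d (\<alpha> s) c y [u, v, w, x]) has_real_derivative ext_d (d_dq \<alpha> q) c y [u, v, w, x]) (at q)"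
  unfolding ext_d_4 d_dq_def
  by (intro DERIV_add DERIV_diff derivatives_commute(2)[OF U sm, simplified])

section \<open>Smoothness of the forms of a family\<close>

lemma su3_family_alt_form:
  assumes "su3_family M F P N" "c \<in> atlas M" "y \<in> img_of c"
  shows "alt_form 2 (F q c y)" "alt_form 3 (P q c y)" "alt_form 3 (N q c y)"
proof -
  have "su3_structure M (F q) (P q) (N q)" using assms(1) by (simp add: su3_family_def)
  hence "diff_form M 2 (F q)" "diff_form M 3 (P q)" "diff_form M 3 (N q)"
    unfolding su3_structure_def by blast+
  thus "alt_form 2 (F q c y)" "alt_form 3 (P q c y)" "alt_form 3 (N q c y)"
    using assms(2,3) unfolding diff_form_def by blast+
qed

text \<open>
  The forms are polynomials in the coefficients of a local coframe, and the coframe can be chosen jointly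
  smooth near any point and any value of \<open>q\<close>.
\<close>

lemma su3_family_smooth:
  assumes M: "smooth_manifold M" and fam: "su3_family M F P N" and c: "c \<in> atlas M"
  shows "smooth_on (img_of c \<times> UNIV) (\<lambda>z. F (snd z) c (fst z) vs)"
    and "smooth_on (img_of c \<times> UNIV) (\<lambda>z. P (snd z) c (fst z) vs)"
    and "smooth_on (img_of c \<times> UNIV) (\<lambda>z. N (snd z) c (fst z) vs)"
proof -
  have opU: "open (img_of c)" using M c by (simp add: smooth_manifold_def)
  have op: "open (img_of c \<times> (UNIV :: real set))" using opU by (simp add: open_Times)
  have deg: "of_degree 2 (F q c y)" "of_degree 3 (P q c y)" "of_degree 3 (N q c y)" if "y \<in> img_of c" for q y
    using su3_family_alt_form[OF fam c that] by (auto intro: alt_form_of_degree)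
  have loc: "smooth_on (img_of c \<times> UNIV) (\<lambda>z. A (snd z) c (fst z) vs)"
    if zero: "\<And>q y. length vs \<noteq> k \<Longrightarrow> y \<in> img_of c \<Longrightarrow> A q c y vs = 0"
      and expr: "\<And>e V I. length vs = k \<Longrightarrow> open V \<Longrightarrow> open I \<Longrightarrow> 
        (\<And>i v. i \<in> {1..6} \<Longrightarrow> smooth_on (V \<times> I) (\<lambda>z. e i (snd z) (fst z) [v])) \<Longrightarrow>
        (\<And>x q. x \<in> V \<Longrightarrow> q \<in> I \<Longrightarrow> su3_coframe (\<lambda>i. e i q x) (F q c x) (P q c x) (N q c x)) \<Longrightarrow>
        smooth_on (V \<times> I) (\<lambda>z. A (snd z) c (fst z) vs)"
    for A :: "real \<Rightarrow> ('a, real^6) dform" and k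
  proof (cases "length vs = k")
    case False
    show ?thesis
      by (rule smooth_on_cong[OF op _ smooth_on_const[of _ 0]]) (use zero False in auto)
  next
    case True
    show ?thesis
    proof (rule smooth_on_local)
      fix z assume "z \<in> img_of c \<times> (UNIV :: real set)"
      then obtain y q0 where z: "z = (y, q0)" "y \<in> img_of c" by (cases z) auto
      obtain V I e where V: "open V" "y \<in> V" "V \<subseteq> img_of c" and I: "open I" "q0 \<in> I"
        and sm: "\<forall>i\<in>{1..6}. \<forall>v. smooth_on (V \<times> I) (\<lambda>(x, q). e i q x [v])"
        and co: "\<forall>x\<in>V. \<forall>q\<in>I. su3_coframe (\<lambda>i. e i q x) (F q c x) (P q c x) (N q c x)"
        using fam[unfolded su3_family_def, THEN conjunct2, rule_format, OF c z(2), of q0]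
        by (elim exE conjE) (rule that)
      have "smooth_on (V \<times> I) (\<lambda>z. A (snd z) c (fst z) vs)"
        by (rule expr[OF True V(1) I(1)]) (use sm co in \<open>auto simp: case_prod_unfold\<close>)
      thus "\<exists>U. open U \<and> z \<in> U \<and> smooth_on U (\<lambda>z. A (snd z) c (fst z) vs)"
        using z V I by (intro exI[of _ "V \<times> I"]) (auto simp: open_Times)
    qed
  qed
  note intros = smooth_on_add smooth_on_diff smooth_on_mult smooth_on_minus
  show "smooth_on (img_of c \<times> UNIV) (\<lambda>z. F (snd z) c (fst z) vs)"
  proof (rule loc[where k = 2])
    fix e V I assume len: "length vs = 2" and V: "open V" "open I"
      and sm: "\<And>i v. i \<in> {1..6} \<Longrightarrow> smooth_on (V \<times> I) (\<lambda>z. e i (snd z) (fst z) [v])"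
      and co: "\<And>x q. x \<in> V \<Longrightarrow> q \<in> I \<Longrightarrow> su3_coframe (\<lambda>i. e i q x) (F q c x) (P q c x) (N q c x)"
    obtain u v where vs: "vs = [u, v]" using len by (auto simp: eval_nat_numeral length_Suc_conv)
    have op: "open (V \<times> I)" using V by (simp add: open_Times)
    show "smooth_on (V \<times> I) (\<lambda>z. F (snd z) c (fst z) vs)" unfolding vs
      by (rule smooth_on_cong[OF op su3_coframe_F[OF co, symmetric]]) (auto intro!: intros op sm[simplified])
  qed (use deg in \<open>auto simp: of_degree_def\<close>)
  show "smooth_on (img_of c \<times> UNIV) (\<lambda>z. P (snd z) c (fst z) vs)"
  proof (rule loc[where k = 3])
    fix e V I assume len: "length vs = 3" and V: "open V" "open I"
      and sm: "\<And>i v. i \<in> {1..6} \<Longrightarrow> smooth_on (V \<times> I) (\<lambda>z. e i (snd z) (fst z) [v])"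
      and co: "\<And>x q. x \<in> V \<Longrightarrow> q \<in> I \<Longrightarrow> su3_coframe (\<lambda>i. e i q x) (F q c x) (P q c x) (N q c x)"
    obtain u v w where vs: "vs = [u, v, w]" using len by (auto simp: eval_nat_numeral length_Suc_conv)
    have op: "open (V \<times> I)" using V by (simp add: open_Times)
    show "smooth_on (V \<times> I) (\<lambda>z. P (snd z) c (fst z) vs)" unfolding vs
      by (rule smooth_on_cong[OF op su3_coframe_\<Psi>(3)[OF co, symmetric]])
        (auto simp: complex_volume_def intro!: intros op sm[simplified])
  qed (use deg in \<open>auto simp: of_degree_def\<close>)
  show "smooth_on (img_of c \<times> UNIV) (\<lambda>z. N (snd z) c (fst z) vs)"
  proof (rule loc[where k = 3])
    fix e V I assume len: "length vs = 3" and V: "open V" "open I"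
      and sm: "\<And>i v. i \<in> {1..6} \<Longrightarrow> smooth_on (V \<times> I) (\<lambda>z. e i (snd z) (fst z) [v])"
      and co: "\<And>x q. x \<in> V \<Longrightarrow> q \<in> I \<Longrightarrow> su3_coframe (\<lambda>i. e i q x) (F q c x) (P q c x) (N q c x)"
    obtain u v w where vs: "vs = [u, v, w]" using len by (auto simp: eval_nat_numeral length_Suc_conv)
    have op: "open (V \<times> I)" using V by (simp add: open_Times)
    show "smooth_on (V \<times> I) (\<lambda>z. N (snd z) c (fst z) vs)" unfolding vs
      by (rule smooth_on_cong[OF op su3_coframe_\<Psi>(4)[OF co, symmetric]])
        (auto simp: complex_volume_def intro!: intros op sm[simplified])
  qed (use deg in \<open>auto simp: of_degree_def\<close>)
qed

section \<open>The lifted form on the cylinder\<close>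

lemma img_of_cyl_chart: "img_of (cyl_chart c) = img_of c \<times> UNIV"
  by (auto simp: cyl_chart_def image_iff)

lemma lift_form_cyl_chart:
  "lift_form F N (cyl_chart c) z =
    (\<lambda>vs. wedge (\<lambda>vs. F (snd z) c (fst z) (map fst vs)) (dq (cyl_chart c) z) vs - N (snd z) c (fst z) (map fst vs))"
  by (intro ext) (simp add: lift_form_def cyl_form_def[abs_def] base_chart_cyl_chart)

lemma lift_form_3:
  assumes "of_degree 2 (F (snd z) c (fst z))"
  shows "lift_form F N (cyl_chart c) z [u, v, w] =
    F (snd z) c (fst z) [fst u, fst v] * snd w - F (snd z) c (fst z) [fst u, fst w] * snd v
    + F (snd z) c (fst z) [fst v, fst w] * snd u - N (snd z) c (fst z) [fst u, fst v, fst w]"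
proof -
  have deg: "of_degree 2 (\<lambda>vs :: ((real^6) \<times> real) list. F (snd z) c (fst z) (map fst vs))"
    using assms by (simp add: of_degree_def)
  show ?thesis unfolding lift_form_cyl_chart wedge_2_dq[OF deg] by simp
qed

lemma open_img_of_chart: "smooth_manifold M \<Longrightarrow> c \<in> atlas M \<Longrightarrow> open (img_of c)"
  by (simp add: smooth_manifold_def)

lemma su3_family_coframe:
  assumes "su3_family M F P N" "c \<in> atlas M" "y \<in> img_of c"
  obtains e where "su3_coframe e (F q c y) (P q c y) (N q c y)"
proof -
  have "su3_structure M (F q) (P q) (N q)" using assms(1) by (simp add: su3_family_def)
  thus ?thesis using assms(2,3) that unfolding su3_structure_def by blast
qed

lemma g2_star_lift_form:
  assumes "su3_family M F P N" "c \<in> atlas M" "y \<in> img_of c"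
  shows "g2_star (lift_form F N (cyl_chart c) (y, q)) vs =
    1/2 * wedge (F q c y) (F q c y) (map fst vs) + wedge (\<lambda>vs. P q c y (map fst vs)) (dq (cyl_chart c) (y, q)) vs"
proof -
  obtain e where e: "su3_coframe e (F q c y) (P q c y) (N q c y)" using su3_family_coframe[OF assms] .
  show ?thesis
    unfolding lift_form_cyl_chart fst_conv snd_conv g2_star_eq[OF su3_coframe_g2(1)[OF e]]
    by (rule su3_coframe_g2(2)[OF e])
qed

lemma alt_form_lift_form:
  assumes "su3_family M F P N" "c \<in> atlas M" "y \<in> img_of c"
  shows "alt_form 3 (lift_form F N (cyl_chart c) (y, q))"
proof -
  obtain e where e: "su3_coframe e (F q c y) (P q c y) (N q c y)" using su3_family_coframe[OF assms] .
  show ?thesis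
    unfolding lift_form_cyl_chart fst_conv snd_conv by (rule g2_form_alt[OF su3_coframe_g2(1)[OF e]])
qed

lemma smooth_lift_form:
  assumes M: "smooth_manifold M" and fam: "su3_family M F P N" and c: "c \<in> atlas M"
  shows "smooth_on (img_of c \<times> UNIV) (\<lambda>z. lift_form F N (cyl_chart c) z vs)"
proof -
  have op: "open (img_of c \<times> (UNIV :: real set))" using open_img_of_chart[OF M c] by (simp add: open_Times)
  note sm = su3_family_smooth[OF M fam c]
  show ?thesis
  proof (cases "length vs = 3")
    case True
    then obtain u v w where vs: "vs = [u, v, w]" by (auto simp: eval_nat_numeral length_Suc_conv)
    have "lift_form F N (cyl_chart c) z [u, v, w] =
      F (snd z) c (fst z) [fst u, fst v] * snd w - F (snd z) c (fst z) [fst u, fst w] * snd v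
      + F (snd z) c (fst z) [fst v, fst w] * snd u - N (snd z) c (fst z) [fst u, fst v, fst w]"
      if "z \<in> img_of c \<times> UNIV" for z
      using that by (intro lift_form_3 alt_form_of_degree su3_family_alt_form[OF fam c]) auto
    note eq = this[symmetric]
    show ?thesis unfolding vs
      by (rule smooth_on_cong[OF op eq])
        (auto intro!: smooth_on_add smooth_on_diff smooth_on_mult smooth_on_const sm op)
  next
    case False
    hence "0 = lift_form F N (cyl_chart c) z vs" if "z \<in> img_of c \<times> UNIV" for z
      using that alt_form_eq_0[OF alt_form_lift_form[OF fam c]] by (cases z) auto
    from smooth_on_cong[OF op this smooth_on_const] show ?thesis .
  qed
qed

text \<open>
  The transition maps of the cylinder are those of \<open>M\<close> times the identity.
\<close>

lemma frechet_derivative_cyl_transition: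
  assumes M: "smooth_manifold M" and c: "c \<in> atlas M" and d: "d \<in> atlas M" and p: "p \<in> dom_of c \<inter> dom_of d"
  shows "frechet_derivative (transition (cyl_chart c) (cyl_chart d)) (at (coord c p, q)) =
    (\<lambda>(h, t). (frechet_derivative (transition c d) (at (coord c p)) h, t))"
proof -
  have op: "open (img_of c \<times> (UNIV :: real set))" using open_img_of_chart[OF M c] by (simp add: open_Times)
  have hom: "homeomorphic_map (subtopology (fst M) (dom_of c)) (top_of_set (img_of c)) (coord c)"
    and "openin (fst M) (dom_of c)"
    using M c by (simp_all add: smooth_manifold_def)
  hence "topspace (subtopology (fst M) (dom_of c)) = dom_of c"
    using openin_subset by (auto simp: topspace_subtopology)
  hence inj: "inj_on (coord c) (dom_of c)"
    using homeomorphic_imp_injective_map[OF hom] by simp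
  hence inj': "inj_on (coord (cyl_chart c)) (dom_of (cyl_chart c))"
    by (auto simp: cyl_chart_def inj_on_def)
  have tr: "transition (cyl_chart c) (cyl_chart d) z = (transition c d (fst z), snd z)"
    if "z \<in> img_of c \<times> UNIV" for z
  proof -
    from that obtain p' q' where z: "z = (coord c p', q')" "p' \<in> dom_of c" by auto
    have "inv_into (dom_of c) (coord c) (coord c p') = p'" using inj z(2) by (rule inv_into_f_f)
    moreover have "inv_into (dom_of (cyl_chart c)) (coord (cyl_chart c)) (coord (cyl_chart c) (p', q')) = (p', q')"
      using inj' by (rule inv_into_f_f) (simp add: cyl_chart_def z)
    ultimately show ?thesis by (simp add: transition_def z cyl_chart_def)
  qed
  have "smooth_on (coord c ` (dom_of c \<inter> dom_of d)) (transition c d)"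
    using M c d by (simp add: smooth_manifold_def)
  hence "transition c d differentiable at (coord c p)"
    by (rule smooth_on_differentiable) (use p in auto)
  hence T: "(transition c d has_derivative frechet_derivative (transition c d) (at (coord c p))) (at (coord c p))"
    by (rule differentiable_frechet)
  have "((\<lambda>z. transition c d (fst z)) has_derivative
      (\<lambda>h. frechet_derivative (transition c d) (at (coord c p)) (fst h))) (at (coord c p, q))"
    using has_derivative_compose[OF has_derivative_fst[OF has_derivative_ident], of "transition c d" _ "(coord c p, q)" UNIV]
      T by simp
  from has_derivative_Pair[OF this has_derivative_snd[OF has_derivative_ident]]
  have "((\<lambda>z. (transition c d (fst z), snd z)) has_derivative
      (\<lambda>h. (frechet_derivative (transition c d) (at (coord c p)) (fst h), snd h))) (at (coord c p, q))" .
  moreover have "frechet_derivative (transition (cyl_chart c) (cyl_chart d)) (at (coord c p, q)) =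
      frechet_derivative (\<lambda>z. (transition c d (fst z), snd z)) (at (coord c p, q))"
    by (rule frechet_derivative_cong_open[OF op _ tr]) (use p in auto)
  ultimately show ?thesis by (simp add: frechet_derivative_eqI case_prod_unfold)
qed

lemma wedge_map: "wedge \<alpha> \<beta> (map f vs) = wedge (\<lambda>xs. \<alpha> (map f xs)) (\<lambda>xs. \<beta> (map f xs)) vs"
  by (simp add: wedge_def nths_map)

lemma diff_form_lift_form:
  assumes M: "smooth_manifold M" and fam: "su3_family M F P N"
  shows "diff_form (cylinder M) 3 (lift_form F N)"
  unfolding diff_form_def
proof (intro conjI ballI allI)
  fix c' assume "c' \<in> atlas (cylinder M)"
  then obtain c where c: "c' = cyl_chart c" "c \<in> atlas M" by (auto simp: cylinder_def)
  show "alt_form 3 (lift_form F N c' z)" if "z \<in> img_of c'" for z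
    using that alt_form_lift_form[OF fam c(2)] unfolding c(1) img_of_cyl_chart by auto
  show "smooth_on (img_of c') (\<lambda>z. lift_form F N c' z vs)" for vs
    unfolding c(1) img_of_cyl_chart by (rule smooth_lift_form[OF M fam c(2)])
  fix d' p' vs assume "d' \<in> atlas (cylinder M)" and p': "p' \<in> dom_of c' \<inter> dom_of d'"
  then obtain d where d: "d' = cyl_chart d" "d \<in> atlas M" by (auto simp: cylinder_def)
  obtain p q where p: "p' = (p, q)" "p \<in> dom_of c \<inter> dom_of d" 
    using p' by (cases p') (auto simp: c d cyl_chart_def)
  define D where "D = frechet_derivative (transition c d) (at (coord c p))"
  define D' where "D' = frechet_derivative (transition c' d') (at (coord c' p'))"
  have coords: "coord c' p' = (coord c p, q)" "coord d' p' = (coord d p, q)"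
    by (simp_all add: c d p cyl_chart_def)
  have D': "D' = (\<lambda>(h, t). (D h, t))"
    unfolding D'_def D_def coords unfolding c(1) d(1) by (rule frechet_derivative_cyl_transition[OF M c(2) d(2) p(2)])
  have mapfst: "map fst (map D' ws) = map D (map fst ws)" for ws by (simp add: D' case_prod_unfold)
  have dqD: "dq d' z (map D' ws) = dq c' z' ws" for ws z z'
    by (auto simp: dq_def D' case_prod_unfold split: list.splits)
  have "su3_structure M (F q) (P q) (N q)" using fam by (simp add: su3_family_def)
  hence "diff_form M 2 (F q)" "diff_form M 3 (N q)" unfolding su3_structure_def by blast+
  hence FN: "F q c (coord c p) ws = F q d (coord d p) (map D ws)" "N q c (coord c p) ws = N q d (coord d p) (map D ws)" for ws
    unfolding diff_form_def D_def using c(2) d(2) p(2) by blast+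
  have "lift_form F N c' (coord c' p') vs = lift_form F N d' (coord d' p') (map D' vs)"
    unfolding coords unfolding c(1) d(1) lift_form_cyl_chart fst_conv snd_conv wedge_map mapfst FN[symmetric]
    unfolding dqD[unfolded c(1) d(1), of _ _ "(coord c p, q)"] ..
  thus "lift_form F N c' (coord c' p') vs =
      lift_form F N d' (coord d' p') (map (frechet_derivative (transition c' d') (at (coord c' p'))) vs)"
    by (simp only: D'_def)
qed

lemma g2_structure_lift_form:
  fixes M :: "('a, real^6) manifold"
  assumes M: "smooth_manifold M" and fam: "su3_family M F P N"
  shows "g2_structure (cylinder M) (lift_form F N)"
  unfolding g2_structure_def
proof (intro conjI ballI)
  show "diff_form (cylinder M) 3 (lift_form F N)" by (rule diff_form_lift_form[OF M fam])
  fix c' z assume "c' \<in> atlas (cylinder M)" and z': "z \<in> img_of c'"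
  then obtain c where c: "c' = cyl_chart c" "c \<in> atlas M" by (auto simp: cylinder_def)
  obtain y q0 where z: "z = (y, q0)" "y \<in> img_of c" using z' unfolding c(1) img_of_cyl_chart by auto
  obtain V I e where V: "open V" "y \<in> V" "V \<subseteq> img_of c" and I: "open I" "q0 \<in> I"
    and sm: "\<forall>i\<in>{1..6}. \<forall>v. smooth_on (V \<times> I) (\<lambda>(x, q). e i q x [v])"
    and co: "\<forall>x\<in>V. \<forall>q\<in>I. su3_coframe (\<lambda>i. e i q x) (F q c x) (P q c x) (N q c x)"
    using fam[unfolded su3_family_def, THEN conjunct2, rule_format, OF c(2) z(2), of q0]
    by (elim exE conjE) (rule that)
  have op: "open (V \<times> I)" using V I by (simp add: open_Times)
  define f where "f i z = cyl_coframe (\<lambda>i. e i (snd z) (fst z)) i" for i and z :: "(real^6) \<times> real"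
  have "smooth_on (V \<times> I) (\<lambda>z. f i z [v])" if "i \<in> {1..7}" for i v
  proof -
    have sm': "smooth_on (V \<times> I) (\<lambda>z. e j (snd z) (fst z) [w])" if "j \<in> {1..6}" for j w
      using sm that by (auto simp: case_prod_unfold)
    consider "i = 1" | "i = 2" | "i = 7" | "i \<in> {3..6}" using \<open>i \<in> {1..7}\<close> by force
    thus ?thesis
      by cases (auto simp: f_def cyl_coframe_def intro!: smooth_on_minus smooth_on_const op sm'[simplified])
  qed
  moreover have "g2_coframe (\<lambda>i. f i z) (lift_form F N c' z)" if "z \<in> V \<times> I" for z
  proof -
    have "su3_coframe (\<lambda>i. e i (snd z) (fst z)) (F (snd z) c (fst z)) (P (snd z) c (fst z)) (N (snd z) c (fst z))"
      using co that by auto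
    from su3_coframe_g2(1)[OF this] show ?thesis unfolding f_def c(1) lift_form_cyl_chart .
  qed
  ultimately show "\<exists>V e. open V \<and> z \<in> V \<and> V \<subseteq> img_of c' \<and>
        (\<forall>i\<in>{1..7}. \<forall>v. smooth_on V (\<lambda>x. e i x [v])) \<and>
        (\<forall>x\<in>V. g2_coframe (\<lambda>i. e i x) (lift_form F N c' x))"
    using op V I z unfolding c(1) img_of_cyl_chart
    by (intro exI[of _ "V \<times> I"] exI[of _ f]) auto
qed

section \<open>The equation for the lifted form\<close>

text \<open>
  In coordinates, $d\phi = (\partial_q\Psi_- + dF) \wedge dq - d\Psi_-$. Each derivative in a direction
  \<open>(h, t)\<close> splits into one along \<open>M\<close> and \<open>t\<close> times one in \<open>q\<close>; the terms with $\partial_qF$ are multiplied by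
  $dq \wedge dq$ and cancel.
\<close>

lemma ext_d_lift_form:
  fixes q :: real
  assumes M: "smooth_manifold M" and fam: "su3_family M F P N" and c: "c \<in> atlas M" and y: "y \<in> img_of c"
  defines "\<beta> \<equiv> (\<lambda>vs. d_dq N q c y (map fst vs) + ext_d (F q) c y (map fst vs))"
  shows "ext_d (lift_form F N) (cyl_chart c) (y, q) [u, v, w, x] =
    \<beta> [u, v, w] * snd x - \<beta> [u, v, x] * snd w + \<beta> [u, w, x] * snd v - \<beta> [v, w, x] * snd u
    - ext_d (N q) c y (map fst [u, v, w, x])"
proof -
  have op: "open (img_of c \<times> (UNIV :: real set))" using open_img_of_chart[OF M c] by (simp add: open_Times)
  have yq: "(y, q) \<in> img_of c \<times> (UNIV :: real set)" using y by simp
  define f where "f vs z = F (snd z) c (fst z) vs" for vs z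
  define n where "n vs z = N (snd z) c (fst z) vs" for vs z
  have df: "f vs differentiable at (y, q)" and dn: "n vs differentiable at (y, q)" for vs
    unfolding f_def[abs_def] n_def[abs_def]
    by (rule smooth_on_differentiable[OF su3_family_smooth(1)[OF M fam c] yq]
        smooth_on_differentiable[OF su3_family_smooth(3)[OF M fam c] yq])+
  have f: "frechet_derivative (f vs) (at (y, q)) r =
      frechet_derivative (\<lambda>z. F q c z vs) (at y) (fst r) + snd r * deriv (\<lambda>s. F s c y vs) q" for vs r
    using joint_derivative(3)[OF df, of vs "fst r" "snd r"] by (simp add: f_def)
  have n: "frechet_derivative (n vs) (at (y, q)) r =
      frechet_derivative (\<lambda>z. N q c z vs) (at y) (fst r) + snd r * d_dq N q c y vs" for vs r
    using joint_derivative(3)[OF dn, of vs "fst r" "snd r"] by (simp add: n_def d_dq_def)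
  have D: "frechet_derivative (\<lambda>z. lift_form F N (cyl_chart c) z [a, b, d]) (at (y, q)) r =
      frechet_derivative (f [fst a, fst b]) (at (y, q)) r * snd d - frechet_derivative (f [fst a, fst d]) (at (y, q)) r * snd b
      + frechet_derivative (f [fst b, fst d]) (at (y, q)) r * snd a - frechet_derivative (n [fst a, fst b, fst d]) (at (y, q)) r"
    for a b d r
  proof -
    have "frechet_derivative (\<lambda>z. lift_form F N (cyl_chart c) z [a, b, d]) (at (y, q)) =
        frechet_derivative (\<lambda>z. f [fst a, fst b] z * snd d - f [fst a, fst d] z * snd b
          + f [fst b, fst d] z * snd a - n [fst a, fst b, fst d] z) (at (y, q))"
      unfolding f_def n_def
      by (intro frechet_derivative_cong_open[OF op yq] lift_form_3 alt_form_of_degree su3_family_alt_form[OF fam c]) auto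
    also have "\<dots> = (\<lambda>r. frechet_derivative (f [fst a, fst b]) (at (y, q)) r * snd d
        - frechet_derivative (f [fst a, fst d]) (at (y, q)) r * snd b
        + frechet_derivative (f [fst b, fst d]) (at (y, q)) r * snd a
        - frechet_derivative (n [fst a, fst b, fst d]) (at (y, q)) r)"
      by (intro frechet_derivative_eqI has_derivative_diff has_derivative_add has_derivative_mult_left
          differentiable_frechet df dn)
    finally show ?thesis by simp
  qed
  show ?thesis
    unfolding ext_d_4 D f n \<beta>_def list.map ext_d_3 by (simp add: algebra_simps)
qed

text \<open>
  The two equations are the components of $d\phi = 4{*}\phi$ with and without a factor \<open>dq\<close>. They are
  separated by evaluation on vectors tangent to \<open>M\<close> and on three such vectors together with the
  \<open>q\<close>-direction.
\<close>

lemma nearly_parallel_lift_form_iff: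
  fixes M :: "('a, real^6) manifold"
  assumes M: "smooth_manifold M" and fam: "su3_family M F P N"
  shows "nearly_parallel_g2 (cylinder M) (lift_form F N) \<longleftrightarrow>
    (\<forall>q. form_eq M (d_dq N q) (\<lambda>c y vs. 4 * P q c y vs - ext_d (F q) c y vs) \<and>
         form_eq M (ext_d (N q)) (\<lambda>c y vs. - 2 * wedge (F q c y) (F q c y) vs))"
    (is "?L \<longleftrightarrow> ?R")
proof -
  have deg: "of_degree 2 (F q c y)" "of_degree 3 (P q c y)" "of_degree 3 (N q c y)"
    if "c \<in> atlas M" "y \<in> img_of c" for c y q
    using su3_family_alt_form[OF fam that] by (auto intro: alt_form_of_degree)
  have op: "open (img_of c)" if "c \<in> atlas M" for c using open_img_of_chart[OF M that] .
  define E1 where "E1 c y q \<longleftrightarrow> (\<forall>u v w. d_dq N q c y [u, v, w] = 4 * P q c y [u, v, w] - ext_d (F q) c y [u, v, w])" for c y q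
  define E2 where "E2 c y q \<longleftrightarrow> (\<forall>u v w x. ext_d (N q) c y [u, v, w, x] = - 2 * wedge (F q c y) (F q c y) [u, v, w, x])" for c y q
  have R1: "d_dq N q c y = (\<lambda>vs. 4 * P q c y vs - ext_d (F q) c y vs) \<longleftrightarrow> E1 c y q"
    if cy: "c \<in> atlas M" "y \<in> img_of c" for c y q
  proof
    assume E1: "E1 c y q"
    show "d_dq N q c y = (\<lambda>vs. 4 * P q c y vs - ext_d (F q) c y vs)"
    proof
      fix vs
      show "d_dq N q c y vs = 4 * P q c y vs - ext_d (F q) c y vs"
      proof (cases "length vs = 3")
        case True
        then obtain u v w where "vs = [u, v, w]" by (auto simp: eval_nat_numeral length_Suc_conv)
        thus ?thesis using E1 by (simp add: E1_def)
      next
        case False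
        have "ext_d (F q) c y vs = 0"
          by (rule ext_d_wrong_degree[OF op[OF cy(1)] cy(2), of 2]) (use deg cy False in auto)
        moreover have "N s c y vs = 0" "P q c y vs = 0" for s
          using deg[OF cy] False by (auto simp: of_degree_def)
        ultimately show ?thesis by (simp add: d_dq_def)
      qed
    qed
  qed (simp add: E1_def)
  have R2: "ext_d (N q) c y = (\<lambda>vs. - 2 * wedge (F q c y) (F q c y) vs) \<longleftrightarrow> E2 c y q"
    if cy: "c \<in> atlas M" "y \<in> img_of c" for c y q
  proof
    assume E2: "E2 c y q"
    show "ext_d (N q) c y = (\<lambda>vs. - 2 * wedge (F q c y) (F q c y) vs)"
    proof
      fix vs
      show "ext_d (N q) c y vs = - 2 * wedge (F q c y) (F q c y) vs"
      proof (cases "length vs = 4")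
        case True
        then obtain u v w x where "vs = [u, v, w, x]" by (auto simp: eval_nat_numeral length_Suc_conv)
        thus ?thesis using E2 by (simp add: E2_def)
      next
        case False
        have "ext_d (N q) c y vs = 0"
          by (rule ext_d_wrong_degree[OF op[OF cy(1)] cy(2), of 3]) (use deg cy False in auto)
        moreover have "wedge (F q c y) (F q c y) vs = 0"
          using wedge_eq_0[OF deg(1)[OF cy] deg(1)[OF cy]] False by simp
        ultimately show ?thesis by simp
      qed
    qed
  qed (simp add: E2_def)
  have L: "ext_d (lift_form F N) (cyl_chart c) (y, q) = (\<lambda>vs. 4 * g2_star (lift_form F N (cyl_chart c) (y, q)) vs)
      \<longleftrightarrow> E1 c y q \<and> E2 c y q" if cy: "c \<in> atlas M" "y \<in> img_of c" for c y q
  proof -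
    define A where "A = ext_d (lift_form F N) (cyl_chart c) (y, q)"
    define B where "B = (\<lambda>vs. 4 * g2_star (lift_form F N (cyl_chart c) (y, q)) vs)"
    define \<gamma> where "\<gamma> vs = d_dq N q c y (map fst vs) + ext_d (F q) c y (map fst vs) - 4 * P q c y (map fst vs)" for vs :: "((real^6) \<times> real) list"
    have degP: "of_degree 3 (\<lambda>vs :: ((real^6) \<times> real) list. P q c y (map fst vs))"
      using deg[OF cy] by (simp add: of_degree_def)
    have AB: "A [u, v, w, x] - B [u, v, w, x] =
      \<gamma> [u, v, w] * snd x - \<gamma> [u, v, x] * snd w + \<gamma> [u, w, x] * snd v - \<gamma> [v, w, x] * snd u
      - (ext_d (N q) c y (map fst [u, v, w, x]) + 2 * wedge (F q c y) (F q c y) (map fst [u, v, w, x]))" for u v w x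
      unfolding A_def B_def ext_d_lift_form[OF M fam cy] g2_star_lift_form[OF fam cy] wedge_3_dq[OF degP] \<gamma>_def
      by (simp add: algebra_simps)
    have "A vs = B vs" if "length vs \<noteq> 4" for vs
    proof -
      have "A vs = 0" unfolding A_def
      proof (rule ext_d_wrong_degree)
        show "open (img_of c \<times> (UNIV::real set))" using op[OF cy(1)] by (simp add: open_Times)
        show "of_degree 3 (lift_form F N (cyl_chart c) z)" if "z \<in> img_of c \<times> UNIV" for z
          using that alt_form_lift_form[OF fam cy(1)] by (cases z) (auto intro: alt_form_of_degree)
      qed (use cy that in auto)
      moreover have "wedge (F q c y) (F q c y) (map fst vs) = 0"
        using wedge_eq_0[OF deg(1)[OF cy] deg(1)[OF cy]] that by simp
      moreover have "wedge (\<lambda>vs. P q c y (map fst vs)) (dq (cyl_chart c) (y, q)) vs = 0"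
        using wedge_eq_0[OF degP alt_form_of_degree[OF alt_form_dq]] that by simp
      ultimately show ?thesis by (simp add: B_def g2_star_lift_form[OF fam cy])
    qed
    hence "A = B \<longleftrightarrow> (\<forall>vs. length vs = 4 \<longrightarrow> A vs = B vs)" by (metis ext)
    also have "\<dots> \<longleftrightarrow> (\<forall>u v w x. A [u, v, w, x] - B [u, v, w, x] = 0)"
      by (auto simp: eval_nat_numeral length_Suc_conv)
    also have "\<dots> \<longleftrightarrow> E1 c y q \<and> E2 c y q"
    proof
      assume *: "\<forall>u v w x. A [u, v, w, x] - B [u, v, w, x] = 0"
      have "E2 c y q" unfolding E2_def
      proof (intro allI)
        fix u v w x
        show "ext_d (N q) c y [u, v, w, x] = - 2 * wedge (F q c y) (F q c y) [u, v, w, x]"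
          using *[unfolded AB, rule_format, of "(u, 0)" "(v, 0)" "(w, 0)" "(x, 0)"] by simp
      qed
      moreover have "E1 c y q" unfolding E1_def
      proof (intro allI)
        fix u v w
        show "d_dq N q c y [u, v, w] = 4 * P q c y [u, v, w] - ext_d (F q) c y [u, v, w]"
          using *[unfolded AB, rule_format, of "(u, 0)" "(v, 0)" "(w, 0)" "(0, 1)"] \<open>E2 c y q\<close>
          by (simp add: E2_def \<gamma>_def)
      qed
      ultimately show "E1 c y q \<and> E2 c y q" by blast
    next
      assume "E1 c y q \<and> E2 c y q"
      thus "\<forall>u v w x. A [u, v, w, x] - B [u, v, w, x] = 0"
        unfolding AB by (simp add: E1_def E2_def \<gamma>_def)
    qed
    finally show ?thesis by (simp only: A_def B_def)
  qed
  have "?L \<longleftrightarrow> (\<forall>c\<in>atlas M. \<forall>y\<in>img_of c. \<forall>q. ext_d (lift_form F N) (cyl_chart c) (y, q) =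
      (\<lambda>vs. 4 * g2_star (lift_form F N (cyl_chart c) (y, q)) vs))"
  proof -
    have "atlas (cylinder M) = cyl_chart ` atlas M" by (simp add: cylinder_def)
    hence 1: "(\<forall>d\<in>atlas (cylinder M). Q d) \<longleftrightarrow> (\<forall>c\<in>atlas M. Q (cyl_chart c))" for Q
      by simp
    have 2: "(\<forall>z\<in>img_of (cyl_chart c). R z) \<longleftrightarrow> (\<forall>y\<in>img_of c. \<forall>q. R (y, q))"
      for c :: "('a, real^6) chart" and R
      unfolding img_of_cyl_chart by blast
    show ?thesis
      unfolding nearly_parallel_g2_def form_eq_def 1 2 using g2_structure_lift_form[OF M fam] by blast
  qed
  also have "\<dots> \<longleftrightarrow> (\<forall>c\<in>atlas M. \<forall>y\<in>img_of c. \<forall>q. E1 c y q \<and> E2 c y q)"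
    using L by blast
  also have "\<dots> \<longleftrightarrow> ?R"
    unfolding form_eq_def using R1 R2 by blast
  finally show ?thesis .
qed

lemma diff_form_smooth:
  assumes "diff_form M k \<omega>" "c \<in> atlas M"
  shows "smooth_on (img_of c) (\<lambda>y. \<omega> c y vs)"
  by (rule assms(1)[unfolded diff_form_def, THEN conjunct1, rule_format, OF assms(2), THEN conjunct2, rule_format])

text \<open>
  Applying \<open>d\<close> to $\partial_q\Psi_- = 4\Psi_+ - dF$ gives $\partial_q\,d\Psi_- = 4\,d\Psi_+$, as \<open>d\<close> commutes
  with $\partial_q$ and $d^2F = 0$.
\<close>

lemma evolution_derivative:
  assumes M: "smooth_manifold M" and fam: "su3_family M F P N" and c: "c \<in> atlas M" and y: "y \<in> img_of c"
    and evol: "form_eq M (d_dq N q) (\<lambda>c y vs. 4 * P q c y vs - ext_d (F q) c y vs)"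
  shows "((\<lambda>s. ext_d (N s) c y [u, v, w, x]) has_real_derivative 4 * ext_d (P q) c y [u, v, w, x]) (at q)"
proof -
  note U = open_img_of_chart[OF M c] y
  have str: "su3_structure M (F q) (P q) (N q)" using fam by (simp add: su3_family_def)
  hence "diff_form M 2 (F q)" "diff_form M 3 (P q)" unfolding su3_structure_def by blast+
  hence smF: "smooth_on (img_of c) (\<lambda>z. F q c z vs)" and smP: "smooth_on (img_of c) (\<lambda>z. P q c z vs)" for vs
    using diff_form_smooth[OF _ c] by blast+
  have dP: "(\<lambda>z. P q c z vs) differentiable at y" for vs
    by (rule smooth_on_differentiable[OF smP y])
  have ddF: "(\<lambda>z. ext_d (F q) c z [a, b, d]) differentiable at y" for a b d
    unfolding ext_d_3
    by (intro differentiable_add differentiable_diff smooth_on_differentiable[OF smooth_on_frechet_derivative[OF smF] y])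
  have D: "frechet_derivative (\<lambda>z. 4 * P q c z [a, b, d] - ext_d (F q) c z [a, b, d]) (at y) r =
      4 * frechet_derivative (\<lambda>z. P q c z [a, b, d]) (at y) r - frechet_derivative (\<lambda>z. ext_d (F q) c z [a, b, d]) (at y) r" for a b d r
    by (rule fun_cong[OF frechet_derivative_eqI[OF has_derivative_diff[OF
        has_derivative_mult_right[OF differentiable_frechet[OF dP]] differentiable_frechet[OF ddF]]]])
  have "ext_d (d_dq N q) c y [u, v, w, x] = ext_d (\<lambda>c y vs. 4 * P q c y vs - ext_d (F q) c y vs) c y [u, v, w, x]"
    using evol c unfolding form_eq_def by (intro ext_d_cong_open[OF U]) blast
  also have "\<dots> = 4 * ext_d (P q) c y [u, v, w, x] - ext_d (ext_d (F q)) c y [u, v, w, x]"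
    unfolding ext_d_4 D by simp
  also have "\<dots> = 4 * ext_d (P q) c y [u, v, w, x]"
    using ext_d_ext_d[of "img_of c" y "F q" c, OF U smF] by simp
  finally have eq: "ext_d (d_dq N q) c y [u, v, w, x] = 4 * ext_d (P q) c y [u, v, w, x]" .
  show ?thesis
    unfolding eq[symmetric] by (rule ext_d_d_dq_commute[of "img_of c" y N c, OF U su3_family_smooth(3)[OF M fam c]])
qed

lemma wedge_family_derivative:
  assumes M: "smooth_manifold M" and fam: "su3_family M F P N" and c: "c \<in> atlas M" and y: "y \<in> img_of c"
  shows "((\<lambda>s. wedge (F s c y) (F s c y) [u, v, w, x]) has_real_derivative
    d_dq (\<lambda>s c y. wedge (F s c y) (F s c y)) q c y [u, v, w, x]) (at q)"
proof -
  have deg: "of_degree 2 (F s c y)" for s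
    using su3_family_alt_form(1)[OF fam c y] by (rule alt_form_of_degree)
  have "(\<lambda>s. F s c y vs) differentiable at q" for vs
  proof -
    have "(\<lambda>z. F (snd z) c (fst z) vs) differentiable at (y, q)"
      by (rule smooth_on_differentiable[OF su3_family_smooth(1)[OF M fam c]]) (simp add: y)
    from joint_derivative(2)[OF this] show ?thesis
      unfolding real_differentiable_def by auto
  qed
  hence "(\<lambda>s. wedge (F s c y) (F s c y) [u, v, w, x]) differentiable at q"
    unfolding wedge_2_2[OF deg]
    by (intro differentiable_mult differentiable_add differentiable_diff differentiable_const)
  thus ?thesis unfolding d_dq_def
    using DERIV_deriv_iff_real_differentiable by blast
qed

text \<open>
  \<open>E1\<close> and \<open>E2\<close> are the components of $d\phi = 4{*}\phi$, and \<open>E3\<close> is the second evolution equation. Given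
  \<open>E1\<close>, the \<open>q\<close>-derivative of $d\Psi_- + 2F \wedge F$ is $4(d\Psi_+ + \frac12\partial_q(F \wedge F))$. So \<open>E2\<close> for
  all \<open>q\<close> implies \<open>E3\<close>, and \<open>E3\<close> together with \<open>E2\<close> at $q = 0$ implies \<open>E2\<close> for all \<open>q\<close>.
\<close>

lemma nearly_parallel_iff_evolution:
  assumes M: "smooth_manifold M" and su3: "su3_structure M F0 P0 N0"
    and fam: "su3_family M F P N"
    and ini: "initial_value M F F0" "initial_value M N N0"
  shows "nearly_parallel_g2 (cylinder M) (lift_form F N) \<longleftrightarrow>
    nearly_half_flat M F0 P0 N0 \<and> nearly_half_flat_evolution M F P N"
proof -
  define E1 where "E1 \<longleftrightarrow> (\<forall>q. form_eq M (d_dq N q) (\<lambda>c y vs. 4 * P q c y vs - ext_d (F q) c y vs))"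
  define E2 where "E2 q \<longleftrightarrow> form_eq M (ext_d (N q)) (\<lambda>c y vs. - 2 * wedge (F q c y) (F q c y) vs)" for q
  define E3 where "E3 q \<longleftrightarrow> form_eq M (ext_d (P q))
            (\<lambda>c y vs. - (1/2) * d_dq (\<lambda>s c y. wedge (F s c y) (F s c y)) q c y vs)" for q
  have L: "nearly_parallel_g2 (cylinder M) (lift_form F N) \<longleftrightarrow> E1 \<and> (\<forall>q. E2 q)"
    unfolding nearly_parallel_lift_form_iff[OF M fam] E1_def E2_def by blast
  have evol: "nearly_half_flat_evolution M F P N \<longleftrightarrow> E1 \<and> (\<forall>q. E3 q)"
    unfolding nearly_half_flat_evolution_def E1_def E3_def by blast
  have op: "open (img_of c)" if "c \<in> atlas M" for c using open_img_of_chart[OF M that] .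
  have half: "nearly_half_flat M F0 P0 N0 \<longleftrightarrow> E2 0"
  proof -
    have "ext_d (N 0) c y = ext_d N0 c y" "F 0 c y = F0 c y" if "c \<in> atlas M" "y \<in> img_of c" for c y
      using ini that unfolding initial_value_def form_eq_def
      by (auto intro!: ext ext_d_cong_open[OF op[OF that(1)] that(2)])
    thus ?thesis unfolding nearly_half_flat_def E2_def form_eq_def using su3 by simp
  qed
  have deg: "of_degree 2 (F q c y)" "of_degree 3 (P q c y)" "of_degree 3 (N q c y)"
    if "c \<in> atlas M" "y \<in> img_of c" for c y q
    using su3_family_alt_form[OF fam that] by (auto intro: alt_form_of_degree)
  have dP: "((\<lambda>s. ext_d (N s) c y [u, v, w, x]) has_real_derivative 4 * ext_d (P q) c y [u, v, w, x]) (at q)"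
    if E1 "c \<in> atlas M" "y \<in> img_of c" for c y q u v w x
    using evolution_derivative[OF M fam that(2,3)] that(1) unfolding E1_def by blast
  have dFF: "((\<lambda>s. - 2 * wedge (F s c y) (F s c y) [u, v, w, x]) has_real_derivative
      - 2 * d_dq (\<lambda>s c y. wedge (F s c y) (F s c y)) q c y [u, v, w, x]) (at q)"
    if "c \<in> atlas M" "y \<in> img_of c" for c y q u v w x
    by (intro DERIV_cmult wedge_family_derivative[OF M fam that])
  have "E3 q" if E1 and "\<forall>q. E2 q" for q
    unfolding E3_def form_eq_def
  proof (intro ballI ext)
    fix c y and vs :: "(real^6) list" assume cy: "c \<in> atlas M" "y \<in> img_of c"
    show "ext_d (P q) c y vs = - (1/2) * d_dq (\<lambda>s c y. wedge (F s c y) (F s c y)) q c y vs"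
    proof (cases "length vs = 4")
      case True
      then obtain u v w x where vs: "vs = [u, v, w, x]" by (auto simp: eval_nat_numeral length_Suc_conv)
      have "ext_d (N s) c y = (\<lambda>vs. - 2 * wedge (F s c y) (F s c y) vs)" for s
        using \<open>\<forall>q. E2 q\<close> cy unfolding E2_def form_eq_def by blast
      hence "(\<lambda>s. ext_d (N s) c y [u, v, w, x]) = (\<lambda>s. - 2 * wedge (F s c y) (F s c y) [u, v, w, x])"
        by simp
      from DERIV_unique[OF dP[OF \<open>E1\<close> cy, of u v w x q, unfolded this] dFF[OF cy]] 
      show ?thesis unfolding vs by simp
    next
      case False
      have "ext_d (P q) c y vs = 0"
        by (rule ext_d_wrong_degree[OF op[OF cy(1)] cy(2), of 3]) (use deg cy False in auto)
      moreover have "wedge (F s c y) (F s c y) vs = 0" for s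
        using wedge_eq_0[OF deg(1)[OF cy] deg(1)[OF cy]] False by simp
      ultimately show ?thesis by (simp add: d_dq_def)
    qed
  qed
  moreover have "E2 q" if E1 "\<forall>q. E3 q" "E2 0" for q
    unfolding E2_def form_eq_def
  proof (intro ballI ext)
    fix c y and vs :: "(real^6) list" assume cy: "c \<in> atlas M" "y \<in> img_of c"
    show "ext_d (N q) c y vs = - 2 * wedge (F q c y) (F q c y) vs"
    proof (cases "length vs = 4")
      case True
      then obtain u v w x where vs: "vs = [u, v, w, x]" by (auto simp: eval_nat_numeral length_Suc_conv)
      define k where "k s = ext_d (N s) c y vs - (- 2 * wedge (F s c y) (F s c y) vs)" for s
      have "ext_d (P s) c y = (\<lambda>vs. - (1/2) * d_dq (\<lambda>s c y. wedge (F s c y) (F s c y)) s c y vs)" for s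
        using that(2) cy unfolding E3_def form_eq_def by blast
      hence "(k has_real_derivative 0) (at s)" for s
        using DERIV_diff[OF dP[OF \<open>E1\<close> cy, of u v w x s] dFF[OF cy, of u v w x s]] unfolding k_def[abs_def] vs by simp
      hence "k q = k 0" by (rule DERIV_isconst_all[rule_format])
      moreover have "ext_d (N 0) c y = (\<lambda>vs. - 2 * wedge (F 0 c y) (F 0 c y) vs)"
        using that(3) cy unfolding E2_def form_eq_def by blast
      hence "k 0 = 0" by (simp add: k_def)
      ultimately show ?thesis by (simp add: k_def)
    next
      case False
      have "ext_d (N q) c y vs = 0"
        by (rule ext_d_wrong_degree[OF op[OF cy(1)] cy(2), of 3]) (use deg cy False in auto)
      moreover have "wedge (F q c y) (F q c y) vs = 0"
        using wedge_eq_0[OF deg(1)[OF cy] deg(1)[OF cy]] False by simp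
      ultimately show ?thesis by simp
    qed
  qed
  ultimately show ?thesis unfolding L half evol by blast
qed

theorem proposition5p2:
  fixes M :: "('a, real^6) manifold"
    and F \<Psi>\<^sub>p \<Psi>\<^sub>m :: "('a, real^6) dform"
  assumes "smooth_manifold M"
    and "su3_structure M F \<Psi>\<^sub>p \<Psi>\<^sub>m"
  shows "((\<exists>Fq \<Psi>pq \<Psi>mq. su3_family M Fq \<Psi>pq \<Psi>mq \<and>
             initial_value M Fq F \<and> initial_value M \<Psi>pq \<Psi>\<^sub>p \<and> initial_value M \<Psi>mq \<Psi>\<^sub>m \<and>
             nearly_parallel_g2 (cylinder M) (lift_form Fq \<Psi>mq)) \<longleftrightarrow>
          nearly_half_flat M F \<Psi>\<^sub>p \<Psi>\<^sub>m \<and>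
          (\<exists>Fq \<Psi>pq \<Psi>mq. su3_family M Fq \<Psi>pq \<Psi>mq \<and>
             initial_value M Fq F \<and> initial_value M \<Psi>pq \<Psi>\<^sub>p \<and> initial_value M \<Psi>mq \<Psi>\<^sub>m \<and>
             nearly_half_flat_evolution M Fq \<Psi>pq \<Psi>mq)) \<and>
         (\<forall>Fq \<Psi>pq \<Psi>mq. su3_family M Fq \<Psi>pq \<Psi>mq \<and>
             initial_value M Fq F \<and> initial_value M \<Psi>pq \<Psi>\<^sub>p \<and> initial_value M \<Psi>mq \<Psi>\<^sub>m \<longrightarrow>
             (nearly_parallel_g2 (cylinder M) (lift_form Fq \<Psi>mq) \<longleftrightarrow>
              nearly_half_flat M F \<Psi>\<^sub>p \<Psi>\<^sub>m \<and> nearly_half_flat_evolution M Fq \<Psi>pq \<Psi>mq))"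
proof -
  have "nearly_parallel_g2 (cylinder M) (lift_form Fq \<Psi>mq) \<longleftrightarrow>
      nearly_half_flat M F \<Psi>\<^sub>p \<Psi>\<^sub>m \<and> nearly_half_flat_evolution M Fq \<Psi>pq \<Psi>mq"
    if "su3_family M Fq \<Psi>pq \<Psi>mq" "initial_value M Fq F" "initial_value M \<Psi>mq \<Psi>\<^sub>m" for Fq \<Psi>pq \<Psi>mq
    using nearly_parallel_iff_evolution[OF assms that] .
  thus ?thesis by blast
qed

end
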